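(* For each $\ell\in\mathfrak{L}$, there is an operator $T:L_\infty\rightarrow L_1$ such that (1) $L(T)=S(T)=L_\ell\cup \ell$, (2) $K(T)=L_\ell$, (3) $V(T)=\ell$.
   Context: $L_p$ denotes $L_p(0,1)$ with Lebesgue measure; operators are bounded and linear. An operator between Banach spaces is strictly singular if its restriction to any closed infinite-dimensional subspace is not an isomorphism onto its image (i.e. is not invertible onto its image). $L(L_p,L_q)$, $K(L_p,L_q)$, $S(L_p,L_q)$ denote respectively the bounded, the compact, and the strictly singular operators from $L_p$ to $L_q$. For an operator $T:L_\infty\to L_1$, write $T\in L(L_p,L_q)$ when $T$ (defined on the dense subspace $L_\infty$ of $L_p$, $1<p<\infty$) acts as, i.e. extends to, a bounded operator $L_p\to L_q$; $T\in K(L_p,L_q)$ (resp. $T\in S(L_p,L_q)$) when this operator is moreover compact (resp. strictly singular). Define $L(T)=\{(\frac1p,\frac1q)\in(0,1)\times(0,1): T\in L(L_p,L_q)\}$, $K(T)=\{(\frac1p,\frac1q)\in(0,1)\times(0,1): T\in K(L_p,L_q)\}$, $S(T)=\{(\frac1p,\frac1q)\in(0,1)\times(0,1): T\in S(L_p,L_q)\}$, and $V(T)=S(T)\setminus K(T)$. $\mathfrak{L}$ is the set of all affine lines $\ell$ with slope $k(\ell)\in[0,\infty]$ ($\infty$ meaning vertical), intersected with the square $(0,1)\times(0,1)$, such that either: (i) $k(\ell)\in\{0,\infty\}$ and $\ell\cap\{(\alpha,\beta):0<\alpha\le\frac12\le\beta<1\}=\emptyset$; or (ii) $k(\ell)>0$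 and $\ell$ lies entirely below the diagonal $\{(\alpha,\alpha):\alpha\in(0,1)\}$. Each $\ell\in\mathfrak{L}$ decomposes the square $(0,1)\times(0,1)$ into three disjoint regions $L_\ell$, $R_\ell$ and $\ell$, where $L_\ell$ is the left-hand side of $\ell$, that is, the one containing the set $\{(\alpha,\beta):0<\alpha\le\frac12\le\beta<1\}$. *)

theory Defs
  imports "HOL-Analysis.Analysis"
begin

abbreviation unit_meas :: "real measure" where
  "unit_meas \<equiv> lebesgue_on {0<..<1}"

definition ae_eq :: "(real \<Rightarrow> real) \<Rightarrow> (real \<Rightarrow> real) \<Rightarrow> bool" where
  "ae_eq f g \<longleftrightarrow> f \<in> borel_measurable unit_meas \<and> g \<in> borel_measurable unit_meas \<and>
     (AE x in unit_meas. f x = g x)"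

lemma part_equivp_ae_eq: "part_equivp ae_eq"
proof (rule part_equivpI)
  show "\<exists>f. ae_eq f f"
    by (rule exI[of _ "\<lambda>_. 0"]) (simp add: ae_eq_def)
  show "symp ae_eq"
    unfolding symp_def ae_eq_def by (auto elim: eventually_mono)
  show "transp ae_eq"
    unfolding transp_def ae_eq_def by (auto elim: eventually_elim2)
qed

quotient_type L0 = "real \<Rightarrow> real" / partial: ae_eq
  by (rule part_equivp_ae_eq)

instantiation L0 :: real_vector
begin

lift_definition zero_L0 :: L0 is "\<lambda>_. 0"
  by (simp add: ae_eq_def)

lift_definition plus_L0 :: "L0 \<Rightarrow> L0 \<Rightarrow> L0" is "\<lambda>f g x. f x + g x"
  unfolding ae_eq_def by (auto elim: eventually_elim2)

lift_definition minus_L0 :: "L0 \<Rightarrow> L0 \<Rightarrow> L0" is "\<lambda>f g x. f x - g x"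
  unfolding ae_eq_def by (auto elim: eventually_elim2)

lift_definition uminus_L0 :: "L0 \<Rightarrow> L0" is "\<lambda>f x. - f x"
  unfolding ae_eq_def by (auto elim: eventually_mono)

lift_definition scaleR_L0 :: "real \<Rightarrow> L0 \<Rightarrow> L0" is "\<lambda>c f x. c * f x"
  unfolding ae_eq_def by (auto elim: eventually_mono)

instance
  by standard (transfer; auto simp: ae_eq_def algebra_simps)+

end

text \<open>A normed space is given as a linear subspace of an ambient vector space together with a
  function that is a norm on that subspace; neither property is enforced by the type.\<close>

type_synonym 'a nspace = "'a set \<times> ('a \<Rightarrow> real)"

abbreviation carr :: "'a nspace \<Rightarrow> 'a set" where "carr \<equiv> fst"

abbreviation nrm :: "'a nspace \<Rightarrow> 'a \<Rightarrow> real" where "nrm \<equiv> snd"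

definition norm_topology :: "'a::real_vector nspace \<Rightarrow> 'a topology" where
  "norm_topology X = Metric_space.mtopology (carr X) (\<lambda>x y. nrm X (x - y))"

definition bounded_op :: "'a::real_vector nspace \<Rightarrow> 'b::real_vector nspace \<Rightarrow> ('a \<Rightarrow> 'b) \<Rightarrow> bool" where
  "bounded_op X Y T \<longleftrightarrow>
     T ` carr X \<subseteq> carr Y \<and>
     (\<forall>x\<in>carr X. \<forall>y\<in>carr X. T (x + y) = T x + T y) \<and>
     (\<forall>c. \<forall>x\<in>carr X. T (c *\<^sub>R x) = c *\<^sub>R T x) \<and>
     (\<exists>C. \<forall>x\<in>carr X. nrm Y (T x) \<le> C * nrm X x)"

definition compact_op :: "'a::real_vector nspace \<Rightarrow> 'b::real_vector nspace \<Rightarrow> ('a \<Rightarrow> 'b) \<Rightarrow> bool" where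
  "compact_op X Y T \<longleftrightarrow> bounded_op X Y T \<and>
     compactin (norm_topology Y)
       (norm_topology Y closure_of (T ` {x \<in> carr X. nrm X x \<le> 1}))"

definition infinite_dimensional :: "'a::real_vector set \<Rightarrow> bool" where
  "infinite_dimensional E \<longleftrightarrow> \<not> (\<exists>B. finite B \<and> E \<subseteq> span B)"

definition iso_onto_image_on ::
  "'a::real_vector set \<Rightarrow> 'a nspace \<Rightarrow> 'b::real_vector nspace \<Rightarrow> ('a \<Rightarrow> 'b) \<Rightarrow> bool" where
  "iso_onto_image_on E X Y T \<longleftrightarrow>
     inj_on T E \<and> bounded_op (T ` E, nrm Y) (E, nrm X) (inv_into E T)"

definition strictly_singular_op ::
  "'a::real_vector nspace \<Rightarrow> 'b::real_vector nspace \<Rightarrow> ('a \<Rightarrow> 'b) \<Rightarrow> bool" where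
  "strictly_singular_op X Y T \<longleftrightarrow> bounded_op X Y T \<and>
     \<not> (\<exists>E. subspace E \<and> E \<subseteq> carr X \<and> closedin (norm_topology X) E \<and>
            infinite_dimensional E \<and> iso_onto_image_on E X Y T)"

text \<open>Meant for exponents \<open>1 \<le> p < \<infinity>\<close>; the space with exponent \<open>\<infinity>\<close> is \<open>Linf\<close>.\<close>

lift_definition in_Lp :: "real \<Rightarrow> L0 \<Rightarrow> bool" is
  "\<lambda>p f. integrable unit_meas (\<lambda>x. \<bar>f x\<bar> powr p)"
  unfolding ae_eq_def by (intro integrable_cong_AE) (auto elim: eventually_mono)

lift_definition Lp_norm :: "real \<Rightarrow> L0 \<Rightarrow> real" is
  "\<lambda>p f. (\<integral>x. \<bar>f x\<bar> powr p \<partial>unit_meas) powr (1 / p)"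
  unfolding ae_eq_def
  by (intro arg_cong[where f = "\<lambda>t. t powr _"] integral_cong_AE) (auto elim: eventually_mono)

lift_definition ess_bound :: "L0 \<Rightarrow> real \<Rightarrow> bool" is
  "\<lambda>f C. AE x in unit_meas. \<bar>f x\<bar> \<le> C"
proof (rule ext)
  fix f g C assume *: "ae_eq f g"
  have "AE x in unit_meas. f x = g x" using * by (simp add: ae_eq_def)
  then show "(AE x in unit_meas. \<bar>f x\<bar> \<le> C) = (AE x in unit_meas. \<bar>g x\<bar> \<le> C)"
    by (intro eventually_subst) (auto elim: eventually_mono)
qed

definition Lp :: "real \<Rightarrow> L0 nspace" where
  "Lp p = ({f. in_Lp p f}, Lp_norm p)"

definition Linf :: "L0 nspace" where
  "Linf = ({f. \<exists>C. ess_bound f C}, \<lambda>f. Inf {C. 0 \<le> C \<and> ess_bound f C})"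

abbreviation unit_square :: "(real \<times> real) set" where
  "unit_square \<equiv> {0<..<1} \<times> {0<..<1}"

text \<open>An operator on the bounded functions is said to act between two Lebesgue spaces through its
  extension, which is unique by density.\<close>

definition extends_Linf :: "(L0 \<Rightarrow> L0) \<Rightarrow> (L0 \<Rightarrow> L0) \<Rightarrow> bool" where
  "extends_Linf T T' \<longleftrightarrow> (\<forall>f\<in>carr Linf. T' f = T f)"

definition L_set :: "(L0 \<Rightarrow> L0) \<Rightarrow> (real \<times> real) set" where
  "L_set T = {(\<alpha>, \<beta>) \<in> unit_square.
     \<exists>T'. extends_Linf T T' \<and> bounded_op (Lp (1 / \<alpha>)) (Lp (1 / \<beta>)) T'}"

definition K_set :: "(L0 \<Rightarrow> L0) \<Rightarrow> (real \<times> real) set" where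
  "K_set T = {(\<alpha>, \<beta>) \<in> unit_square.
     \<exists>T'. extends_Linf T T' \<and> compact_op (Lp (1 / \<alpha>)) (Lp (1 / \<beta>)) T'}"

definition S_set :: "(L0 \<Rightarrow> L0) \<Rightarrow> (real \<times> real) set" where
  "S_set T = {(\<alpha>, \<beta>) \<in> unit_square.
     \<exists>T'. extends_Linf T T' \<and> strictly_singular_op (Lp (1 / \<alpha>)) (Lp (1 / \<beta>)) T'}"

definition V_set :: "(L0 \<Rightarrow> L0) \<Rightarrow> (real \<times> real) set" where
  "V_set T = S_set T - K_set T"

definition affine_line :: "ereal \<Rightarrow> real \<Rightarrow> (real \<times> real) set" where
  "affine_line k c =
     (if k = \<infinity> then {(\<alpha>, \<beta>). \<alpha> = c} else {(\<alpha>, \<beta>). \<beta> = real_of_ereal k * \<alpha> + c})"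

text \<open>The set that no admissible line may meet; it includes the segments \<open>\<alpha> = 1/2\<close> and
  \<open>\<beta> = 1/2\<close> of its boundary.\<close>

definition corner :: "(real \<times> real) set" where
  "corner = {(\<alpha>, \<beta>). 0 < \<alpha> \<and> \<alpha> \<le> 1/2 \<and> 1/2 \<le> \<beta> \<and> \<beta> < 1}"

text \<open>The parameter \<open>k\<close> is the slope; lines are identified with their trace on the square.
  Lines that miss the square are not excluded; they all have the trace \<open>{}\<close>.\<close>

definition admissible_lines :: "(real \<times> real) set set" where
  "admissible_lines = {l. \<exists>k c. 0 \<le> k \<and> l = affine_line k c \<inter> unit_square \<and>
     (k \<in> {0, \<infinity>} \<and> l \<inter> corner = {} \<or> 0 < k \<and> (\<forall>(\<alpha>, \<beta>) \<in> l. \<beta> < \<alpha>))}"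

text \<open>For a line meeting the square, \<open>left_region\<close> is the half on its upper left; see
  \<open>left_region_affine_line\<close>. The regions into which a line cuts the square are the connected components of its
  complement in the square.\<close>

definition left_region :: "(real \<times> real) set \<Rightarrow> (real \<times> real) set" where
  "left_region l = (THE C. C \<in> components (unit_square - l) \<and> corner \<subseteq> C)"

lemma left_region_halfspace:
  fixes n :: "real \<times> real" and d :: real
  assumes l: "l = {z \<in> unit_square. n \<bullet> z = d}"
    and corner: "corner \<subseteq> {z. n \<bullet> z > d}"
  shows "left_region l = {z \<in> unit_square. n \<bullet> z > d}"
proof -
  define C where "C = {z \<in> unit_square. n \<bullet> z > d}"
  have sq: "convex unit_square" by (intro convex_Times) auto
  have pt: "(1/2, 1/2) \<in> corner" by (simp add: corner_def)
  have sub: "C \<subseteq> unit_square - l" by (auto simp: C_def l)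
  have cC: "corner \<subseteq> C" using corner by (auto simp: C_def corner_def)
  have "C = unit_square \<inter> {z. n \<bullet> z > d}" by (auto simp: C_def)
  then have conn: "connected C"
    using sq convex_halfspace_gt[of d n] by (metis convex_Int convex_connected)
  have max: "D = C" if D: "connected D" "D \<subseteq> unit_square - l" "C \<subseteq> D" for D
  proof -
    have "D \<subseteq> {z. n \<bullet> z > d} \<union> {z. n \<bullet> z < d}" using D(2) by (auto simp: l)
    moreover have "open {z. n \<bullet> z > d}" "open {z. n \<bullet> z < d}"
      by (rule open_halfspace_gt, rule open_halfspace_lt)
    moreover have "{z. n \<bullet> z > d} \<inter> {z. n \<bullet> z < d} \<inter> D = {}" by auto
    moreover have "{z. n \<bullet> z > d} \<inter> D \<noteq> {}" using pt cC D(3) by (auto simp: C_def)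
    ultimately have "{z. n \<bullet> z < d} \<inter> D = {}"
      using connectedD[OF D(1)] by blast
    then have le: "n \<bullet> z \<ge> d" if "z \<in> D" for z using that by force
    have "D \<subseteq> C"
    proof
      fix z assume z: "z \<in> D"
      then have "z \<in> unit_square" "n \<bullet> z \<noteq> d" using D(2) unfolding l by blast+
      then show "z \<in> C" using le[OF z] by (simp add: C_def)
    qed
    then show ?thesis using D(3) by simp
  qed
  have comp: "C \<in> components (unit_square - l)"
    unfolding in_components_maximal using conn sub max pt cC by blast
  have "left_region l = C"
    unfolding left_region_def
  proof (rule the_equality)
    show "C \<in> components (unit_square - l) \<and> corner \<subseteq> C" using comp cC by simp
    fix E assume "E \<in> components (unit_square - l) \<and> corner \<subseteq> E"
    then show "E = C" using comp pt cC components_nonoverlap by blast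
  qed
  then show ?thesis by (simp add: C_def)
qed

lemma left_region_empty: "left_region {} = unit_square"
proof -
  have "left_region {} = {z \<in> unit_square. (0 :: real \<times> real) \<bullet> z > -1}"
    by (rule left_region_halfspace) auto
  then show ?thesis by auto
qed

lemma left_region_affine_line:
  assumes k: "0 \<le> k" and l: "l = affine_line k c \<inter> unit_square" and ne: "l \<noteq> {}"
    and adm: "k \<in> {0, \<infinity>} \<and> l \<inter> corner = {} \<or> 0 < k \<and> (\<forall>(\<alpha>, \<beta>) \<in> l. \<beta> < \<alpha>)"
  shows "left_region l =
    {(\<alpha>, \<beta>) \<in> unit_square. if k = \<infinity> then \<alpha> < c else real_of_ereal k * \<alpha> + c < \<beta>}"
proof (cases "k = \<infinity>")
  case True
  have c: "0 < c" "c < 1" using ne by (auto simp: l affine_line_def True)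
  have "(c, c) \<in> l" using c by (simp add: l affine_line_def True)
  then have disj: "l \<inter> corner = {}" using adm by auto
  have "1/2 < c"
  proof (rule ccontr)
    assume "\<not> 1/2 < c"
    then have "(c, 1/2) \<in> l \<inter> corner" using c by (simp add: l affine_line_def True corner_def)
    then show False using disj by blast
  qed
  have "left_region l = {z \<in> unit_square. (-1, 0) \<bullet> z > - c}"
  proof (rule left_region_halfspace)
    show "l = {z \<in> unit_square. (-1, 0) \<bullet> z = - c}"
      unfolding l affine_line_def by (auto simp: True)
    show "corner \<subseteq> {z. (-1, 0) \<bullet> z > - c}"
      using \<open>1/2 < c\<close> by (auto simp: corner_def)
  qed
  also have "\<dots> = {(\<alpha>, \<beta>) \<in> unit_square. \<alpha> < c}"
    by (rule set_eqI) (auto simp: split_beta inner_prod_def)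
  finally show ?thesis using True by simp
next
  case False
  define m where "m = real_of_ereal k"
  have m0: "0 \<le> m" using k by (simp add: m_def real_of_ereal_pos)
  have mem: "(x, y) \<in> l \<longleftrightarrow> y = m * x + c \<and> 0 < x \<and> x < 1 \<and> 0 < y \<and> y < 1" for x y
    using False by (auto simp: l affine_line_def m_def)
  obtain a b where ab: "(a, b) \<in> l" using ne by auto
  have "m * x + c < y" if xy: "(x, y) \<in> corner" for x y
  proof (rule ccontr)
    assume neg: "\<not> m * x + c < y"
    have xy': "0 < x" "x \<le> 1/2" "1/2 \<le> y" "y < 1" using xy by (auto simp: corner_def)
    show False
      using adm
    proof
      assume A: "k \<in> {0, \<infinity>} \<and> l \<inter> corner = {}"
      then have "m = 0" using False by (auto simp: m_def)
      then have "(1/2, c) \<in> l \<inter> corner"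
        using ab neg xy' by (simp add: mem corner_def)
      then show False using A by blast
    next
      assume A: "0 < k \<and> (\<forall>(\<alpha>, \<beta>) \<in> l. \<beta> < \<alpha>)"
      then have below: "q < p" if "(p, q) \<in> l" for p q using that by auto
      have ba: "b = m * a + c" "b < a" "0 < a" "a < 1" "0 < b"
        using ab below[OF ab] unfolding mem by blast+
      show False
      proof (cases "x \<le> a")
        case True
        then have "m * x + c < 1" using m0 ba mult_left_mono[OF True m0] by linarith
        then have "(x, m * x + c) \<in> l" unfolding mem using neg xy' by linarith
        then show False using below[of x "m * x + c"] neg xy' by linarith
      next
        case False
        have "isCont (\<lambda>t. m * t + c - t) t" for t by (intro continuous_intros)
        moreover have "m * a + c - a \<le> 0" "0 \<le> m * x + c - x" "a \<le> x"
          using False ba neg xy' by linarith+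
        ultimately obtain t where "a \<le> t" "t \<le> x" "m * t + c - t = 0"
          using IVT[of "\<lambda>t. m * t + c - t" a 0 x] by blast
        then have "(t, t) \<in> l" unfolding mem using ba xy' by linarith
        then show False using below by blast
      qed
    qed
  qed
  then have "c < b - m * a" if "(a, b) \<in> corner" for a b
    using that by (simp add: less_diff_eq add.commute)
  then have sub: "corner \<subseteq> {z. (- m, 1) \<bullet> z > c}" by auto
  have "left_region l = {z \<in> unit_square. (- m, 1) \<bullet> z > c}"
  proof (rule left_region_halfspace[OF _ sub])
    show "l = {z \<in> unit_square. (- m, 1) \<bullet> z = c}"
      by (rule set_eqI) (auto simp: mem)
  qed
  also have "\<dots> = {(\<alpha>, \<beta>) \<in> unit_square. m * \<alpha> + c < \<beta>}"
    by (rule set_eqI) (auto simp: split_beta inner_prod_def)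
  finally show ?thesis using False by (simp add: m_def)
qed

end

theory Submission imports Defs begin

text \<open>
  Write \<open>\<alpha> = 1/p\<close>, \<open>\<beta> = 1/q\<close> and let the line be \<open>b * \<beta> - a * \<alpha> = d\<close> with \<open>a, b \<ge> 0\<close>. For \<open>a > 0\<close>
  let \<open>e\<^sub>n\<^sup>a\<close> be the indicator of an interval of length proportional to \<open>2\<^bsup>-an\<^esup>\<close>, these intervals being
  disjoint, and let \<open>e\<^sub>n\<^sup>0\<close> be the Rademacher functions. The operator is
  \<open>T f = \<Sum>n. 2\<^bsup>(a+d)n\<^esup> (\<integral> f e\<^sub>n\<^sup>a) e\<^sub>n\<^sup>b\<close>. After normalising the two systems in \<open>L\<^sub>p\<close> and \<open>L\<^sub>q\<close> it becomes
  diagonal with entries \<open>2\<close> to the power \<open>-n (b * \<beta> - a * \<alpha> - d)\<close>. To the left of the line the entries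
  decay geometrically, so \<open>T\<close> is a norm limit of finite rank operators; to the right they blow up on the
  functions \<open>e\<^sub>n\<^sup>a\<close>. On the line they are all \<open>1\<close> and \<open>T\<close> factors as
  \<open>L\<^sub>p \<rightarrow> \<ell>\<^sub>u \<rightarrow> \<ell>\<^sub>v \<rightarrow> L\<^sub>q\<close>, where \<open>u = p\<close> or, for \<open>a = 0\<close>, \<open>u = 2\<close>, and \<open>v = q\<close> or, for \<open>b = 0\<close>, \<open>v = 2\<close>
  (Khintchine's inequality and its dual). Admissibility of the line says exactly that \<open>u < v\<close>, so the
  formal inclusion in the middle, and with it \<open>T\<close>, is strictly singular; \<open>T\<close> is not compact because it
  maps a bounded sequence to a separated one.
\<close>

subsection \<open>Subspaces with a norm and series of rank-one operators\<close>

text \<open>Nonnegativity and symmetry are demanded outside the carrier as well, because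
  \<open>Metric_space\<close> asks for both without restriction; the other norm laws are local to
  the carrier.\<close>

locale normed_subspace =
  fixes X :: "'a::real_vector nspace"
  assumes subspace: "subspace (carr X)"
    and nrm_nonneg [simp]: "0 \<le> nrm X x"
    and nrm_minus: "nrm X (- x) = nrm X x"
    and nrm_eq_0: "x \<in> carr X \<Longrightarrow> nrm X x = 0 \<Longrightarrow> x = 0"
    and nrm_scaleR: "x \<in> carr X \<Longrightarrow> nrm X (c *\<^sub>R x) = \<bar>c\<bar> * nrm X x"
    and nrm_add: "x \<in> carr X \<Longrightarrow> y \<in> carr X \<Longrightarrow> nrm X (x + y) \<le> nrm X x + nrm X y"
begin

lemma carr_add: "x \<in> carr X \<Longrightarrow> y \<in> carr X \<Longrightarrow> x + y \<in> carr X"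
  and carr_diff: "x \<in> carr X \<Longrightarrow> y \<in> carr X \<Longrightarrow> x - y \<in> carr X"
  and carr_scaleR: "x \<in> carr X \<Longrightarrow> c *\<^sub>R x \<in> carr X"
  and carr_zero: "0 \<in> carr X"
  using subspace by (auto intro: subspace_add subspace_diff subspace_scale subspace_0)

lemma carr_sum: "(\<And>i. i \<in> I \<Longrightarrow> f i \<in> carr X) \<Longrightarrow> sum f I \<in> carr X"
  using subspace by (intro subspace_sum)

lemma nrm_zero [simp]: "nrm X 0 = 0"
  using nrm_scaleR[OF carr_zero, of 0] by simp

lemma nrm_minus_commute: "nrm X (x - y) = nrm X (y - x)"
  using nrm_minus[of "x - y"] by simp

lemma nrm_triangle:
  assumes "x \<in> carr X" "y \<in> carr X" "z \<in> carr X"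
  shows "nrm X (x - z) \<le> nrm X (x - y) + nrm X (y - z)"
  using nrm_add[of "x - y" "y - z"] assms by (simp add: carr_diff)

lemma nrm_le_add_diff:
  assumes "x \<in> carr X" "y \<in> carr X"
  shows "nrm X x \<le> nrm X y + nrm X (x - y)"
  using nrm_add[of y "x - y"] assms by (simp add: carr_diff)

lemma nrm_sum: "(\<And>i. i \<in> I \<Longrightarrow> f i \<in> carr X) \<Longrightarrow> nrm X (sum f I) \<le> (\<Sum>i\<in>I. nrm X (f i))"
proof (induction I rule: infinite_finite_induct)
  case (insert i I)
  then show ?case using nrm_add[of "f i" "sum f I"] by (simp add: carr_sum)
qed auto

sublocale metric: Metric_space "carr X" "\<lambda>x y. nrm X (x - y)"
proof
  fix x y z
  show "nrm X (x - y) = nrm X (y - x)" by (rule nrm_minus_commute)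
  show "x \<in> carr X \<Longrightarrow> y \<in> carr X \<Longrightarrow> (nrm X (x - y) = 0) = (x = y)"
    using nrm_eq_0[of "x - y"] by (auto simp: carr_diff)
qed (auto intro: nrm_triangle)

lemma norm_topology_eq: "norm_topology X = metric.mtopology"
  by (simp add: norm_topology_def)

lemma limit_unique:
  assumes "x \<in> carr X" "y \<in> carr X" "\<And>n. s n \<in> carr X"
    and "(\<lambda>n. nrm X (x - s n)) \<longlonglongrightarrow> 0" "(\<lambda>n. nrm X (y - s n)) \<longlonglongrightarrow> 0"
  shows "x = y"
proof -
  have "nrm X (x - y) \<le> nrm X (x - s n) + nrm X (y - s n)" for n
    using nrm_triangle[OF assms(1,3,2), of n] by (simp add: nrm_minus_commute)
  moreover have "(\<lambda>n. nrm X (x - s n) + nrm X (y - s n)) \<longlonglongrightarrow> 0 + 0"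
    by (intro tendsto_add assms)
  ultimately have "nrm X (x - y) \<le> 0"
    by (metis (no_types, lifting) LIMSEQ_le_const add_0)
  then have "nrm X (x - y) = 0"
    using nrm_nonneg[of "x - y"] by linarith
  then show ?thesis using nrm_eq_0[OF carr_diff] assms(1,2) by force
qed

lemma nrm_limit_le:
  assumes "x \<in> carr X" "\<And>n. s n \<in> carr X" "(\<lambda>n. nrm X (x - s n)) \<longlonglongrightarrow> 0"
    and "\<forall>\<^sub>F n in sequentially. nrm X (s n) \<le> b"
  shows "nrm X x \<le> b"
proof (rule LIMSEQ_le_const)
  show "(\<lambda>n. b + nrm X (x - s n)) \<longlonglongrightarrow> b"
    using tendsto_add[OF tendsto_const assms(3), of b] by simp
  show "\<exists>N. \<forall>n\<ge>N. nrm X x \<le> b + nrm X (x - s n)"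
    using assms(4) nrm_le_add_diff[OF assms(1,2)]
    unfolding eventually_sequentially by (meson add_right_mono order_trans)
qed

end

section \<open>Linear functionals on infinite-dimensional subspaces\<close>

text \<open>Linearity is relative to a set because \<open>pairing\<close> with a fixed function is
  only known to be additive where the products are integrable: the integral of a non-integrable
  function is 0 by default.\<close>

definition linear_on_set :: "'a::real_vector set \<Rightarrow> ('a \<Rightarrow> 'b::real_vector) \<Rightarrow> bool" where
  "linear_on_set E f \<longleftrightarrow> (\<forall>x\<in>E. \<forall>y\<in>E. f (x + y) = f x + f y) \<and> (\<forall>c. \<forall>x\<in>E. f (c *\<^sub>R x) = c *\<^sub>R f x)"

lemma linear_on_set_subset: "linear_on_set E f \<Longrightarrow> F \<subseteq> E \<Longrightarrow> linear_on_set F f"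
  unfolding linear_on_set_def by blast

lemma linear_on_set_diff:
  assumes "linear_on_set E f" "subspace E" "x \<in> E" "y \<in> E"
  shows "f (x - y) = f x - f y"
proof -
  have "(-1) *\<^sub>R y \<in> E" using assms(2,4) subspace_scale by blast
  then have "f (x + (-1) *\<^sub>R y) = f x + (-1) *\<^sub>R f y"
    using assms unfolding linear_on_set_def by metis
  then show ?thesis by simp
qed

lemma linear_on_set_sum:
  assumes "\<And>i. i \<in> I \<Longrightarrow> linear_on_set E (\<phi> i)"
  shows "linear_on_set E (\<lambda>x. \<Sum>i\<in>I. \<phi> i x *\<^sub>R h i)"
  using assms by (auto simp: linear_on_set_def sum.distrib scaleR_add_left scaleR_sum_right
      simp flip: scaleR_scaleR intro!: sum.cong)

text \<open>A kernel has codimension at most one: if finitely many vectors spanned it, adding one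
  \<open>e\<close> with \<open>\<phi> e \<noteq> 0\<close> would span all of
  \<open>E\<close>.\<close>

lemma infinite_dimensional_kernel:
  fixes \<phi> :: "'a::real_vector \<Rightarrow> real"
  assumes E: "subspace E" "infinite_dimensional E" and \<phi>: "linear_on_set E \<phi>"
  shows "subspace {x \<in> E. \<phi> x = 0} \<and> infinite_dimensional {x \<in> E. \<phi> x = 0}"
proof
  have "\<phi> (0 *\<^sub>R 0) = 0 *\<^sub>R \<phi> 0"
    using \<phi> subspace_0[OF E(1)] unfolding linear_on_set_def by blast
  then show "subspace {x \<in> E. \<phi> x = 0}"
    using E(1) \<phi> by (auto simp: subspace_def linear_on_set_def)
  show "infinite_dimensional {x \<in> E. \<phi> x = 0}"
    unfolding infinite_dimensional_def
  proof
    assume "\<exists>B. finite B \<and> {x \<in> E. \<phi> x = 0} \<subseteq> span B"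
    then obtain B where B: "finite B" "{x \<in> E. \<phi> x = 0} \<subseteq> span B" by blast
    show False
    proof (cases "\<forall>x\<in>E. \<phi> x = 0")
      case True
      then have "{x \<in> E. \<phi> x = 0} = E" by blast
      then show ?thesis using B E(2) by (auto simp: infinite_dimensional_def)
    next
      case False
      then obtain e where e: "e \<in> E" "\<phi> e \<noteq> 0" by blast
      have "x \<in> span (insert e B)" if x: "x \<in> E" for x
      proof -
        define y where "y = x - (\<phi> x / \<phi> e) *\<^sub>R e"
        have ee: "(\<phi> x / \<phi> e) *\<^sub>R e \<in> E" using e E(1) by (simp add: subspace_scale)
        then have "\<phi> y = \<phi> x - \<phi> ((\<phi> x / \<phi> e) *\<^sub>R e)"
          unfolding y_def by (intro linear_on_set_diff[OF \<phi> E(1) x])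
        also have "\<dots> = 0" using \<phi> e by (simp add: linear_on_set_def)
        finally have "y \<in> span B"
          using B(2) x ee E(1) by (auto simp: y_def subspace_diff)
        then have "y \<in> span (insert e B)" using span_mono[of B "insert e B"] by blast
        moreover have "x = y + (\<phi> x / \<phi> e) *\<^sub>R e" by (simp add: y_def)
        ultimately show ?thesis
          by (metis insertI1 span_add span_base span_scale)
      qed
      then show False using E(2) B(1) unfolding infinite_dimensional_def by blast
    qed
  qed
qed

text \<open>The functionals are imposed one after another, each time passing to a kernel that is
  still infinite-dimensional. This supplies directions that leave finitely many coordinates
  unchanged, and vectors killed by a finite-rank truncation.\<close>

lemma infinite_dimensional_common_kernel:
  fixes \<phi> :: "'i \<Rightarrow> 'a::real_vector \<Rightarrow> real"
  assumes "finite I" "subspace E" "infinite_dimensional E" "\<And>i. i \<in> I \<Longrightarrow> linear_on_set E (\<phi> i)"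
  shows "\<exists>x\<in>E. x \<noteq> 0 \<and> (\<forall>i\<in>I. \<phi> i x = 0)"
  using assms
proof (induction I arbitrary: E rule: finite_induct)
  case empty
  then show ?case
    unfolding infinite_dimensional_def by (metis finite.emptyI empty_iff insertI1 span_empty subsetI singletonD)
next
  case (insert i I)
  let ?F = "{x \<in> E. \<phi> i x = 0}"
  have "subspace ?F" "infinite_dimensional ?F"
    using infinite_dimensional_kernel[of E "\<phi> i"] insert.prems by auto
  moreover have "linear_on_set ?F (\<phi> j)" if "j \<in> I" for j
    using insert.prems that by (auto intro: linear_on_set_subset)
  ultimately show ?case using insert.IH by blast
qed

text \<open>An extreme point of the unit ball of an \<open>N\<close>-dimensional subspace of \<open>c\<^sub>0\<close> has at least \<open>N\<close>
  coordinates of modulus one. Such a point is found by moving inside the ball, keeping the unimodular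
  coordinates fixed, until a new coordinate becomes unimodular.\<close>

lemma exists_unimodular_coordinates:
  fixes \<phi> :: "nat \<Rightarrow> 'a::real_vector \<Rightarrow> real"
  assumes E: "subspace E" "infinite_dimensional E"
    and lin: "\<And>n. linear_on_set E (\<phi> n)"
    and null: "\<And>x. x \<in> E \<Longrightarrow> (\<lambda>n. \<phi> n x) \<longlonglongrightarrow> 0"
    and inj: "\<And>x. x \<in> E \<Longrightarrow> (\<And>n. \<phi> n x = 0) \<Longrightarrow> x = 0"
  shows "\<exists>x\<in>E. (\<forall>n. \<bar>\<phi> n x\<bar> \<le> 1) \<and> (\<exists>S. finite S \<and> card S = N \<and> (\<forall>n\<in>S. \<bar>\<phi> n x\<bar> = 1))"
proof (induction N)
  case 0
  have "\<phi> n (0 *\<^sub>R 0) = 0 *\<^sub>R \<phi> n 0" for n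
    using lin subspace_0[OF E(1)] unfolding linear_on_set_def by blast
  then show ?case using subspace_0[OF E(1)] by (intro bexI[of _ 0]) auto
next
  case (Suc N)
  then obtain x S where x: "x \<in> E" "\<And>n. \<bar>\<phi> n x\<bar> \<le> 1"
    and S: "finite S" "card S = N" "\<And>n. n \<in> S \<Longrightarrow> \<bar>\<phi> n x\<bar> = 1" by blast
  \<comment> \<open>A direction along which the unimodular coordinates already found do not
    move.\<close>
  obtain y where y: "y \<in> E" "y \<noteq> 0" "\<And>n. n \<in> S \<Longrightarrow> \<phi> n y = 0"
    using infinite_dimensional_common_kernel[where \<phi> = \<phi>, OF S(1) E lin] by auto
  obtain m where m: "\<phi> m y \<noteq> 0" using inj y by blast
  have line: "\<phi> n (x + t *\<^sub>R y) = \<phi> n x + t * \<phi> n y" "x + t *\<^sub>R y \<in> E" for n t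
    using lin[of n] x y E(1) subspace_scale[OF E(1) y(1)]
    by (auto simp: linear_on_set_def subspace_add)
  \<comment> \<open>The times \<open>t \<ge> 0\<close> at which the ray from \<open>x\<close> in
    direction \<open>y\<close> is still in the unit ball: a closed set, bounded because some
    coordinate of \<open>y\<close> is nonzero.\<close>
  define A where "A = {t. 0 \<le> t \<and> (\<forall>n. \<bar>\<phi> n x + t * \<phi> n y\<bar> \<le> 1)}"
  have bd: "t \<le> 2 / \<bar>\<phi> m y\<bar>" if "t \<in> A" for t
  proof -
    have "\<bar>t * \<phi> m y\<bar> \<le> 2" "0 \<le> t"
      using that x(2)[of m] unfolding A_def by (auto dest!: spec[of _ m])
    then show ?thesis using m by (simp add: field_simps abs_mult)
  qed
  have "closed A"
    unfolding A_def by (intro closed_Collect_conj closed_Collect_all closed_Collect_le continuous_intros)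
  moreover have "0 \<in> A" using x by (auto simp: A_def)
  moreover have bdA: "bdd_above A" using bd by (rule bdd_aboveI)
  ultimately have tA: "Sup A \<in> A" by (intro closed_contains_Sup) auto
  define t where "t = Sup A"
  define z where "z = x + t *\<^sub>R y"
  have z: "z \<in> E" "\<And>n. \<bar>\<phi> n z\<bar> \<le> 1" "\<And>n. n \<in> S \<Longrightarrow> \<bar>\<phi> n z\<bar> = 1"
    using tA line S(3) y(3) unfolding t_def z_def A_def by auto
  have "\<exists>k. k \<notin> S \<and> \<bar>\<phi> k z\<bar> = 1"
  proof (rule ccontr)
    assume neg: "\<not> ?thesis"
    obtain N0 where N0: "\<And>n. n \<ge> N0 \<Longrightarrow> \<bar>\<phi> n z\<bar> < 1/2"
      using LIMSEQ_D[OF null[OF z(1)], of "1/2"] by auto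
    \<comment> \<open>A positive lower bound for the slack of all coordinates outside
      \<open>S\<close>. From \<open>N0\<close> on the slack exceeds 1/2 because the coordinates tend
      to 0, so a minimum over finitely many values suffices.\<close>
    define \<delta> where "\<delta> = Min (insert (1/2) ((\<lambda>n. 1 - \<bar>\<phi> n z\<bar>) ` ({..<N0} - S)))"
    have lt1: "\<bar>\<phi> n z\<bar> < 1" if "n \<notin> S" for n
      using neg z(2)[of n] that by (auto simp: order_less_le)
    have \<delta>: "0 < \<delta>" unfolding \<delta>_def using lt1 by (subst Min_gr_iff) auto
    have \<delta>_le: "\<bar>\<phi> n z\<bar> \<le> 1 - \<delta>" if n: "n \<notin> S" for n
    proof (cases "n < N0")
      case True
      then have "\<delta> \<le> 1 - \<bar>\<phi> n z\<bar>" unfolding \<delta>_def using n by (intro Min_le) auto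
      then show ?thesis by simp
    next
      case False
      moreover have "\<delta> \<le> 1/2" unfolding \<delta>_def by (intro Min_le) auto
      ultimately show ?thesis using N0[of n] by simp
    qed
    obtain B where B: "0 < B" "\<And>n. \<bar>\<phi> n y\<bar> \<le> B"
      using convergent_imp_Bseq[OF convergentI[OF null[OF y(1)]]] by (auto simp: Bseq_def)
    \<comment> \<open>Going on for a further time \<open>\<delta> / B\<close> uses up at most the
      slack, against the choice of \<open>t\<close> as the last admissible time.\<close>
    have "\<bar>\<phi> n x + (t + \<delta> / B) * \<phi> n y\<bar> \<le> 1" for n
    proof (cases "n \<in> S")
      case True
      then show ?thesis using y(3) x(2) by simp
    next
      case False
      have "\<bar>(\<delta> / B) * \<phi> n y\<bar> \<le> (\<delta> / B) * B"
        unfolding abs_mult using B(2)[of n] \<delta> B(1) by (intro mult_mono) auto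
      then have "\<bar>(\<delta> / B) * \<phi> n y\<bar> \<le> \<delta>" using B(1) by simp
      moreover have "\<phi> n x + (t + \<delta> / B) * \<phi> n y = \<phi> n z + (\<delta> / B) * \<phi> n y"
        by (simp add: z_def line algebra_simps)
      ultimately show ?thesis using \<delta>_le[OF False] by linarith
    qed
    moreover have "0 \<le> t" using tA by (simp add: t_def A_def)
    ultimately have "t + \<delta> / B \<in> A" using \<delta> B(1) by (simp add: A_def)
    then have "t + \<delta> / B \<le> t" unfolding t_def using bdA by (rule cSup_upper)
    then show False using divide_pos_pos[OF \<delta> B(1)] by linarith
  qed
  then obtain k where "k \<notin> S" "\<bar>\<phi> k z\<bar> = 1" by blast
  then show ?case using z S(1,2)
    by (intro bexI[of _ z] conjI exI[of _ "insert k S"]) auto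
qed

section \<open>Operators given by a series of rank-one terms\<close>

text \<open>\<open>T\<close> is a parameter rather than a limit defined here, so that one map on
  \<open>L0\<close> can serve all pairs of spaces at once; its linearity follows from that of the
  partial sums.\<close>

locale series_op =
  X: normed_subspace X + Y: normed_subspace Y
  for X :: "'a::real_vector nspace" and Y :: "'b::real_vector nspace" +
  fixes \<phi> :: "nat \<Rightarrow> 'a \<Rightarrow> real" and h :: "nat \<Rightarrow> 'b" and T :: "'a \<Rightarrow> 'b"
  assumes lin: "linear_on_set (carr X) (\<phi> n)"
    and h: "h n \<in> carr Y"
    and T: "f \<in> carr X \<Longrightarrow> T f \<in> carr Y"
    and lim: "f \<in> carr X \<Longrightarrow> (\<lambda>N. nrm Y (T f - (\<Sum>n<N. \<phi> n f *\<^sub>R h n))) \<longlonglongrightarrow> 0"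
begin

lemma psum_carr: "(\<Sum>n\<in>I. \<phi> n f *\<^sub>R h n) \<in> carr Y"
  by (intro Y.carr_sum Y.carr_scaleR h)

lemma psum_lin: "linear_on_set (carr X) (\<lambda>f. \<Sum>n\<in>I. \<phi> n f *\<^sub>R h n)"
  by (intro linear_on_set_sum lin)

lemma T_linear: "linear_on_set (carr X) T"
  unfolding linear_on_set_def
proof safe
  fix f g assume f: "f \<in> carr X" and g: "g \<in> carr X"
  let ?S = "\<lambda>N f. \<Sum>n<N. \<phi> n f *\<^sub>R h n"
  show "T (f + g) = T f + T g"
  proof (rule Y.limit_unique[where s = "\<lambda>N. ?S N (f + g)"])
    show "(\<lambda>N. nrm Y (T f + T g - ?S N (f + g))) \<longlonglongrightarrow> 0"
    proof (rule Lim_null_comparison)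
      show "(\<lambda>N. nrm Y (T f - ?S N f) + nrm Y (T g - ?S N g)) \<longlonglongrightarrow> 0"
        using tendsto_add[OF lim[OF f] lim[OF g]] by simp
      have "?S N (f + g) = ?S N f + ?S N g" for N
        using psum_lin f g unfolding linear_on_set_def by blast
      then show "\<forall>\<^sub>F N in sequentially. norm (nrm Y (T f + T g - ?S N (f + g)))
          \<le> nrm Y (T f - ?S N f) + nrm Y (T g - ?S N g)"
        using Y.nrm_add[OF Y.carr_diff[OF T[OF f] psum_carr] Y.carr_diff[OF T[OF g] psum_carr]]
        by (intro always_eventually allI) (simp add: algebra_simps)
    qed
  qed (use f g in \<open>auto intro!: T X.carr_add Y.carr_add psum_carr lim\<close>)
next
  fix c f assume f: "f \<in> carr X"
  let ?S = "\<lambda>N f. \<Sum>n<N. \<phi> n f *\<^sub>R h n"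
  show "T (c *\<^sub>R f) = c *\<^sub>R T f"
  proof (rule Y.limit_unique[where s = "\<lambda>N. ?S N (c *\<^sub>R f)"])
    have "?S N (c *\<^sub>R f) = c *\<^sub>R ?S N f" for N
      using psum_lin f unfolding linear_on_set_def by blast
    then have "nrm Y (c *\<^sub>R T f - ?S N (c *\<^sub>R f)) = \<bar>c\<bar> * nrm Y (T f - ?S N f)" for N
      using Y.nrm_scaleR[OF Y.carr_diff[OF T[OF f] psum_carr], of c]
      by (simp add: scaleR_diff_right)
    then show "(\<lambda>N. nrm Y (c *\<^sub>R T f - ?S N (c *\<^sub>R f))) \<longlonglongrightarrow> 0"
      using tendsto_mult_right_zero[OF lim[OF f], of "\<bar>c\<bar>"] by simp
  qed (use f in \<open>auto intro!: T X.carr_scaleR Y.carr_scaleR psum_carr lim\<close>)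
qed

lemma T_tail_le:
  assumes f: "f \<in> carr X"
    and b: "\<And>N. M \<le> N \<Longrightarrow> nrm Y (\<Sum>n=M..<N. \<phi> n f *\<^sub>R h n) \<le> b"
  shows "nrm Y (T f - (\<Sum>n<M. \<phi> n f *\<^sub>R h n)) \<le> b"
proof (rule Y.nrm_limit_le[where s = "\<lambda>N. (\<Sum>n<N. \<phi> n f *\<^sub>R h n) - (\<Sum>n<M. \<phi> n f *\<^sub>R h n)"])
  have "(\<Sum>n<N. \<phi> n f *\<^sub>R h n) - (\<Sum>n<M. \<phi> n f *\<^sub>R h n) = (\<Sum>n=M..<N. \<phi> n f *\<^sub>R h n)" if "M \<le> N" for N
    using that by (simp add: sum_diff_nat_ivl lessThan_atLeast0)
  then show "\<forall>\<^sub>F N in sequentially.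
      nrm Y ((\<Sum>n<N. \<phi> n f *\<^sub>R h n) - (\<Sum>n<M. \<phi> n f *\<^sub>R h n)) \<le> b"
    using b by (intro eventually_sequentiallyI[of M]) simp
qed (use f lim[OF f] in \<open>auto intro!: T Y.carr_diff psum_carr\<close>)

lemma T_bounded_op:
  assumes "\<And>f. f \<in> carr X \<Longrightarrow> nrm Y (T f) \<le> C * nrm X f"
  shows "bounded_op X Y T"
  using T_linear assms T unfolding bounded_op_def linear_on_set_def by auto

lemma T_strictly_singularI:
  assumes "bounded_op X Y T"
    and "\<And>E C. subspace E \<Longrightarrow> E \<subseteq> carr X \<Longrightarrow> infinite_dimensional E \<Longrightarrow>
      (\<And>f. f \<in> E \<Longrightarrow> nrm X f \<le> C * nrm Y (T f)) \<Longrightarrow> 0 < C \<Longrightarrow> False"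
  shows "strictly_singular_op X Y T"
  unfolding strictly_singular_op_def
proof (intro conjI assms(1) notI, elim exE conjE)
  fix E assume E: "subspace E" "E \<subseteq> carr X" "infinite_dimensional E" "iso_onto_image_on E X Y T"
  then obtain C where C: "\<And>f. f \<in> E \<Longrightarrow> nrm X f \<le> C * nrm Y (T f)"
    unfolding iso_onto_image_on_def bounded_op_def by fastforce
  have le: "nrm X f \<le> max C 1 * nrm Y (T f)" if "f \<in> E" for f
    using C[OF that] mult_right_mono[of C "max C 1" "nrm Y (T f)"] by force
  show False by (rule assms(2)[OF E(1-3) le]) auto
qed

text \<open>The truncations of the series have finite rank and approximate \<open>T\<close>
  uniformly on the unit ball, which makes the image of the ball totally bounded. A lower estimate on
  \<open>E\<close> fails on vectors annihilated by the first \<open>M\<close> coefficients, where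
  \<open>T\<close> has norm at most \<open>\<epsilon> M\<close>.\<close>

lemma T_compact_strictly_singular:
  assumes \<epsilon>: "\<epsilon> \<longlonglongrightarrow> 0"
    and tail: "\<And>f M. f \<in> carr X \<Longrightarrow> nrm Y (T f - (\<Sum>n<M. \<phi> n f *\<^sub>R h n)) \<le> \<epsilon> M * nrm X f"
    and K: "\<And>f n. f \<in> carr X \<Longrightarrow> \<bar>\<phi> n f\<bar> \<le> K n * nrm X f"
    and complete: "Y.metric.mcomplete"
  shows "compact_op X Y T" and "strictly_singular_op X Y T"
proof -
  have bdd: "bounded_op X Y T"
    using tail[of _ 0] by (intro T_bounded_op[where C = "\<epsilon> 0"]) simp
  let ?S = "\<lambda>N f. \<Sum>n<N. \<phi> n f *\<^sub>R h n"
  let ?B = "{f \<in> carr X. nrm X f \<le> 1}"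
  have "Y.metric.mtotally_bounded (T ` ?B)"
    unfolding Y.metric.mtotally_bounded_def
  proof (intro allI impI)
    fix e :: real assume e: "0 < e"
    then obtain M where "\<bar>\<epsilon> M\<bar> < e / 4" using LIMSEQ_D[OF \<epsilon>, of "e/4"] by force
    then have M: "nrm Y (T f - ?S M f) \<le> e / 4" if "f \<in> ?B" for f
    proof -
      have "\<epsilon> M * nrm X f \<le> e / 4 * 1"
        using \<open>\<bar>\<epsilon> M\<bar> < e / 4\<close> that e by (intro mult_mono) auto
      then show ?thesis using tail[of f M] that by simp
    qed
    define H where "H = (\<Sum>n<M. nrm Y (h n))"
    have H: "0 \<le> H" unfolding H_def by (intro sum_nonneg) auto
    \<comment> \<open>Mesh of a grid for the coefficients: an error \<open>\<eta>\<close> in each of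
      them moves the truncation by at most \<open>\<eta> * H < e / 4\<close>. The added 1 covers
      \<open>H = 0\<close>.\<close>
    define \<eta> where "\<eta> = e / (4 * (H + 1))"
    have \<eta>: "0 < \<eta>" using e H by (simp add: \<eta>_def)
    \<comment> \<open>The grid cell of \<open>f\<close>. The bounds \<open>K n\<close> leave
      finitely many cells on the unit ball.\<close>
    define col where "col f = (\<lambda>n\<in>{..<M}. \<lfloor>\<phi> n f / \<eta>\<rfloor>)" for f
    have "col ` ?B \<subseteq> (\<Pi>\<^sub>E n\<in>{..<M}. {\<lfloor>- \<bar>K n\<bar> / \<eta>\<rfloor>..\<lfloor>\<bar>K n\<bar> / \<eta>\<rfloor>})"
    proof (intro image_subsetI PiE_I)
      fix f n assume "f \<in> ?B" and n: "n \<in> {..<M}"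
      then have f: "f \<in> carr X" "nrm X f \<le> 1" by simp_all
      have "\<bar>\<phi> n f\<bar> \<le> \<bar>K n\<bar> * 1"
      proof -
        have "K n * nrm X f \<le> \<bar>K n\<bar> * 1" using f(2) by (intro mult_mono) auto
        then show ?thesis using K[OF f(1), of n] by simp
      qed
      then have "- \<bar>K n\<bar> / \<eta> \<le> \<phi> n f / \<eta>" "\<phi> n f / \<eta> \<le> \<bar>K n\<bar> / \<eta>"
        using \<eta> by (intro divide_right_mono; linarith)+
      then show "col f n \<in> {\<lfloor>- \<bar>K n\<bar> / \<eta>\<rfloor>..\<lfloor>\<bar>K n\<bar> / \<eta>\<rfloor>}"
        using n by (auto simp: col_def intro: floor_mono)
    qed (simp add: col_def)
    then have fin: "finite (col ` ?B)"
      by (rule finite_subset) (auto intro!: finite_PiE)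
    \<comment> \<open>One representative for each occupied cell; their images form the finite
      \<open>e\<close>-net.\<close>
    define R where "R = (\<lambda>c. SOME f. f \<in> ?B \<and> col f = c) ` (col ` ?B)"
    have rep: "\<exists>g\<in>R. g \<in> ?B \<and> col g = col f" if "f \<in> ?B" for f
    proof -
      let ?g = "SOME g. g \<in> ?B \<and> col g = col f"
      have "?g \<in> ?B \<and> col ?g = col f"
        by (rule someI[of _ f]) (use that in auto)
      then show ?thesis using that unfolding R_def by blast
    qed
    have RB: "R \<subseteq> ?B"
    proof
      fix g assume "g \<in> R"
      then obtain f where "f \<in> ?B" and g: "g = (SOME g. g \<in> ?B \<and> col g = col f)"
        unfolding R_def by blast
      then show "g \<in> ?B" using someI[of "\<lambda>g. g \<in> ?B \<and> col g = col f" f] by blast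
    qed
    have "T f \<in> (\<Union>y\<in>T ` R. Y.metric.mball y e)" if f: "f \<in> ?B" for f
    proof -
      obtain g where g: "g \<in> R" "g \<in> ?B" "col g = col f" using rep[OF f] by blast
      have diff: "\<bar>\<phi> n f - \<phi> n g\<bar> \<le> \<eta>" if n: "n < M" for n
      proof -
        have "\<lfloor>\<phi> n f / \<eta>\<rfloor> = \<lfloor>\<phi> n g / \<eta>\<rfloor>"
          using fun_cong[OF g(3), of n] n by (simp add: col_def)
        then have "\<bar>\<phi> n f / \<eta> - \<phi> n g / \<eta>\<bar> \<le> 1"
          using floor_correct[of "\<phi> n f / \<eta>"] floor_correct[of "\<phi> n g / \<eta>"] by linarith
        then have "\<bar>(\<phi> n f - \<phi> n g) / \<eta>\<bar> \<le> 1" by (simp add: diff_divide_distrib)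
        then show ?thesis using \<eta> by (simp add: abs_divide)
      qed
      have "?S M f - ?S M g = (\<Sum>n<M. (\<phi> n f - \<phi> n g) *\<^sub>R h n)"
        by (simp add: sum_subtractf scaleR_diff_left)
      then have "nrm Y (?S M f - ?S M g) \<le> (\<Sum>n<M. nrm Y ((\<phi> n f - \<phi> n g) *\<^sub>R h n))"
        using Y.nrm_sum[of "{..<M}" "\<lambda>n. (\<phi> n f - \<phi> n g) *\<^sub>R h n"]
        by (simp add: Y.carr_scaleR h)
      also have "\<dots> \<le> (\<Sum>n<M. \<eta> * nrm Y (h n))"
        using diff by (intro sum_mono) (simp add: Y.nrm_scaleR h mult_right_mono)
      also have "\<dots> = \<eta> * H" by (simp add: H_def sum_distrib_left)
      also have "\<dots> = e / 4 * (H / (H + 1))" by (simp add: \<eta>_def)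
      also have "\<dots> \<le> e / 4 * 1" using H e by (intro mult_left_mono) auto
      finally have "nrm Y (?S M f - ?S M g) \<le> e / 4" by simp
      moreover have "nrm Y (T g - T f) \<le> nrm Y (T g - ?S M g) + nrm Y (?S M g - T f)"
        "nrm Y (?S M g - T f) \<le> nrm Y (?S M g - ?S M f) + nrm Y (?S M f - T f)"
        using f g by (auto intro!: Y.nrm_triangle psum_carr T)
      ultimately have "nrm Y (T g - T f) < e"
        using M[OF f] M[OF g(2)] e by (simp add: Y.nrm_minus_commute)
      then show ?thesis using f g T by auto
    qed
    moreover have "finite R" unfolding R_def using fin by blast
    ultimately show "\<exists>K. finite K \<and> K \<subseteq> T ` ?B \<and> T ` ?B \<subseteq> (\<Union>x\<in>K. Y.metric.mball x e)"
      using RB by (intro exI[of _ "T ` R"]) blast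
  qed
  then show "compact_op X Y T"
    unfolding compact_op_def Y.norm_topology_eq
    using bdd Y.metric.mtotally_bounded_eq_compact_closure_of[OF complete] by blast
  show "strictly_singular_op X Y T"
  proof (rule T_strictly_singularI[OF bdd])
    fix E C assume E: "subspace E" "E \<subseteq> carr X" "infinite_dimensional E"
      and C: "\<And>f. f \<in> E \<Longrightarrow> nrm X f \<le> C * nrm Y (T f)" "0 < C"
    \<comment> \<open>Chosen so that, on vectors annihilated by the first \<open>M\<close>
      coefficients, \<open>T\<close> shrinks norms below the factor \<open>1 / C\<close> of the
      lower estimate.\<close>
    obtain M where M: "\<bar>\<epsilon> M\<bar> < 1 / C" using LIMSEQ_D[OF \<epsilon>, of "1 / C"] C(2) by force
    obtain f where f: "f \<in> E" "f \<noteq> 0" "\<And>n. n < M \<Longrightarrow> \<phi> n f = 0"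
      using infinite_dimensional_common_kernel[of "{..<M}" E \<phi>] E(1,3)
        linear_on_set_subset[OF lin E(2)] by (metis finite_lessThan lessThan_iff)
    have fX: "f \<in> carr X" using f(1) E(2) by blast
    then have pos: "0 < nrm X f" using X.nrm_eq_0[of f] f(2) X.nrm_nonneg[of f] by linarith
    have "nrm Y (T f) \<le> \<epsilon> M * nrm X f" using tail[OF fX, of M] f(3) by simp
    then have "C * nrm Y (T f) \<le> C * (\<epsilon> M * nrm X f)"
      using C(2) by (intro mult_left_mono) auto
    then have "nrm X f \<le> (C * \<epsilon> M) * nrm X f"
      using C(1)[OF f(1)] by (simp add: mult.assoc)
    moreover have "C * \<epsilon> M < C * (1 / C)"
      using M C(2) by (intro mult_strict_left_mono) auto
    then have "(C * \<epsilon> M) * nrm X f < 1 * nrm X f"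
      using C(2) pos by (intro mult_strict_right_mono) auto
    ultimately show False by simp
  qed
qed

text \<open>\<open>T\<close> is controlled by the inclusion of \<open>\<ell>\<^sub>u\<close> in
  \<open>\<ell>\<^sub>v\<close>. If it were bounded below on \<open>E\<close>, the
  \<open>\<ell>\<^sub>u\<close> norm of the coefficients would be dominated there by their
  \<open>\<ell>\<^sub>v\<close> norm, which fails for vectors with many coordinates of modulus one
  and none larger.\<close>

lemma T_strictly_singular_lp:
  assumes uv: "1 \<le> u" "u < v" and C: "0 < C"
    and up: "\<And>f N. f \<in> carr X \<Longrightarrow> (\<Sum>n<N. \<bar>\<phi> n f\<bar> powr u) \<le> (C * nrm X f) powr u"
    and low: "\<And>f. f \<in> carr X \<Longrightarrow> nrm Y (T f) \<le> C * (\<Sum>n. \<bar>\<phi> n f\<bar> powr v) powr (1 / v)"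
    and bdd: "bounded_op X Y T"
  shows "strictly_singular_op X Y T"
proof (rule T_strictly_singularI[OF bdd])
  fix E M assume E: "subspace E" "E \<subseteq> carr X" "infinite_dimensional E"
    and M: "\<And>f. f \<in> E \<Longrightarrow> nrm X f \<le> M * nrm Y (T f)" "0 < M"
  have smb: "summable (\<lambda>n. \<bar>\<phi> n f\<bar> powr u)" if "f \<in> carr X" for f
    using up[OF that] by (intro summableI_nonneg_bounded[where x = "(C * nrm X f) powr u"]) auto
  have null: "(\<lambda>n. \<phi> n f) \<longlonglongrightarrow> 0" if f: "f \<in> carr X" for f
  proof -
    have "(\<lambda>n. (\<bar>\<phi> n f\<bar> powr u) powr (1/u)) \<longlonglongrightarrow> 0 powr (1/u)"
      using summable_LIMSEQ_zero[OF smb[OF f]] uv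
      by (intro tendsto_powr') auto
    then show ?thesis using uv by (simp add: powr_powr tendsto_rabs_zero_iff)
  qed
  have inj: "f = 0" if f: "f \<in> E" "\<And>n. \<phi> n f = 0" for f
  proof -
    have "nrm Y (T f) \<le> 0" using low[of f] f E by auto
    then have "nrm X f \<le> 0" using M(1)[OF f(1)] M(2) by (meson mult_nonneg_nonpos order_trans less_imp_le)
    then show ?thesis using X.nrm_eq_0[of f] f(1) E X.nrm_nonneg[of f] by force
  qed
  \<comment> \<open>Product of the three constants, from \<open>up\<close>, from the lower estimate
    on \<open>E\<close> and from \<open>low\<close>: on \<open>E\<close> it bounds the
    \<open>\<ell>\<^sub>u\<close> norm of the coefficients by their \<open>\<ell>\<^sub>v\<close>
    norm.\<close>
  define D where "D = C * M * C"
  have D: "0 < D" using C M by (simp add: D_def)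
  define \<theta> where "\<theta> = 1 / u - 1 / v"
  have \<theta>: "0 < \<theta>" using uv by (simp add: \<theta>_def field_simps)
  \<comment> \<open>Large enough that \<open>A powr \<theta> \<le> D\<close>, the inequality reached
    at the end, is impossible for \<open>A \<ge> N\<close>.\<close>
  obtain N :: nat where N: "D powr (1 / \<theta>) < real N" using reals_Archimedean2 by blast
  have linE: "linear_on_set E (\<phi> n)" for n using lin linear_on_set_subset E(2) by blast
  obtain f S where f: "f \<in> E" "\<And>n. \<bar>\<phi> n f\<bar> \<le> 1" and S: "finite S" "card S = N" "\<And>n. n \<in> S \<Longrightarrow> \<bar>\<phi> n f\<bar> = 1"
    using exists_unimodular_coordinates[of E \<phi> N] E linE null inj by blast
  have fX: "f \<in> carr X" using f E by blast
  define A where "A = (\<Sum>n. \<bar>\<phi> n f\<bar> powr u)"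
  have "real N = (\<Sum>n\<in>S. \<bar>\<phi> n f\<bar> powr u)" using S by simp
  also have "\<dots> \<le> A" unfolding A_def by (intro sum_le_suminf smb fX S) auto
  finally have NA: "real N \<le> A" .
  have "0 < real N" using N by (meson le_less_trans powr_ge_zero)
  then have A: "0 < A" using NA by linarith
  \<comment> \<open>All coordinates have modulus at most 1, so the larger exponent gives the smaller
    power, and both norms can be compared through the single quantity \<open>A\<close>.\<close>
  have le: "\<bar>\<phi> n f\<bar> powr v \<le> \<bar>\<phi> n f\<bar> powr u" for n
    using f(2)[of n] uv by (cases "\<phi> n f = 0") (auto intro: powr_mono')
  then have "summable (\<lambda>n. \<bar>\<phi> n f\<bar> powr v)"
    by (intro summable_comparison_test'[OF smb[OF fX], of 0]) auto
  then have "(\<Sum>n. \<bar>\<phi> n f\<bar> powr v) \<le> A"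
    unfolding A_def using le smb[OF fX] by (intro suminf_le) auto
  moreover have "0 \<le> (\<Sum>n. \<bar>\<phi> n f\<bar> powr v)" using \<open>summable (\<lambda>n. \<bar>\<phi> n f\<bar> powr v)\<close> by (intro suminf_nonneg) auto
  ultimately have "(\<Sum>n. \<bar>\<phi> n f\<bar> powr v) powr (1 / v) \<le> A powr (1 / v)"
    using uv by (intro powr_mono2) auto
  then have "nrm Y (T f) \<le> C * A powr (1 / v)"
    using low[OF fX] C by (meson mult_left_mono order_trans less_imp_le)
  then have nf: "C * nrm X f \<le> D * A powr (1 / v)"
  proof -
    have "nrm X f \<le> M * (C * A powr (1 / v))"
      using M(1)[OF f(1)] M(2) mult_left_mono[OF \<open>nrm Y (T f) \<le> C * A powr (1 / v)\<close>, of M] by linarith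
    then have "C * nrm X f \<le> C * (M * (C * A powr (1 / v)))"
      using C by (intro mult_left_mono) auto
    then show ?thesis by (simp add: D_def mult_ac)
  qed
  have "A \<le> (C * nrm X f) powr u"
    unfolding A_def using up[OF fX] smb[OF fX] by (intro suminf_le_const) auto
  then have "A powr (1 / u) \<le> ((C * nrm X f) powr u) powr (1 / u)"
    using A uv by (intro powr_mono2) auto
  then have "A powr (1 / u) \<le> D * A powr (1 / v)"
    using nf C uv by (simp add: powr_powr)
  then have "A powr \<theta> \<le> D"
    using A by (simp add: \<theta>_def powr_diff divide_le_eq mult.commute)
  then have "(A powr \<theta>) powr (1 / \<theta>) \<le> D powr (1 / \<theta>)" using \<theta> by (intro powr_mono2) auto
  then show False using \<theta> A N NA by (simp add: powr_powr)
qed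

end

subsection \<open>The spaces \<open>L\<^sub>p\<close>\<close>

lemma ae_eq_refl_iff [simp]: "ae_eq f f \<longleftrightarrow> f \<in> borel_measurable unit_meas"
  by (simp add: ae_eq_def)

lemma space_unit_meas: "space unit_meas = {0<..<1}"
  by (simp add: space_restrict_space)

lemma emeasure_unit_meas [simp]: "emeasure unit_meas {0<..<1} = 1"
  by (simp add: emeasure_restrict_space)

interpretation unit_meas: finite_measure unit_meas
  by standard (simp add: space_unit_meas)

lemma measure_unit_meas [simp]: "measure unit_meas {0<..<1} = 1"
  by (simp add: measure_def)

lemma borel_measurable_unit_meas: "f \<in> borel_measurable borel \<Longrightarrow> f \<in> borel_measurable unit_meas"
  by (intro measurable_restrict_space1 measurable_completion) simp

lemma L0_cases:
  obtains f where "f \<in> borel_measurable unit_meas" "x = abs_L0 f"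
proof
  show "rep_L0 x \<in> borel_measurable unit_meas"
    using Quotient_rep_reflp[OF Quotient_L0] by simp
  show "x = abs_L0 (rep_L0 x)"
    by (simp add: Quotient_abs_rep[OF Quotient_L0])
qed

lemma sum_abs_L0:
  assumes "\<And>i. i \<in> I \<Longrightarrow> f i \<in> borel_measurable unit_meas"
  shows "(\<Sum>i\<in>I. abs_L0 (f i)) = abs_L0 (\<lambda>x. \<Sum>i\<in>I. f i x)"
  using assms
proof (induction I rule: infinite_finite_induct)
  case (insert i I)
  then show ?case by (simp add: plus_L0.abs_eq)
qed (simp_all add: zero_L0_def)

section \<open>Convexity of the unit ball and Minkowski's inequality\<close>

text \<open>On positive arguments this is convexity of the power function. If one argument is 0 it
  reduces to \<open>s powr p \<le> s\<close> for \<open>s\<close> in the unit interval.\<close>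

lemma powr_convex_nonneg:
  fixes a b t p :: real
  assumes "1 \<le> p" "0 \<le> a" "0 \<le> b" "0 \<le> t" "t \<le> 1"
  shows "((1 - t) * a + t * b) powr p \<le> (1 - t) * a powr p + t * b powr p"
proof -
  have scale: "(s * c) powr p \<le> s * c powr p" if "0 \<le> s" "s \<le> 1" "0 \<le> c" for s c :: real
  proof -
    have "s powr p \<le> s"
      using that assms(1) powr_mono'[of 1 p s] by (cases "s = 0") auto
    then show ?thesis using that by (simp add: powr_mult mult_right_mono)
  qed
  consider "a = 0" | "b = 0" | "0 < a" "0 < b" using assms by fastforce
  then show ?thesis
  proof cases
    case 3
    then show ?thesis
      using convex_onD[OF powr_convex[OF assms(1)], of t a b] assms by simp
  qed (use scale[of t b] scale[of "1 - t" a] assms in auto)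
qed

lemma integrable_powr_lincomb:
  fixes f g :: "real \<Rightarrow> real"
  assumes p: "1 \<le> p" and t: "0 \<le> t" "t \<le> 1"
    and f: "f \<in> borel_measurable unit_meas" "integrable unit_meas (\<lambda>x. \<bar>f x\<bar> powr p)"
    and g: "g \<in> borel_measurable unit_meas" "integrable unit_meas (\<lambda>x. \<bar>g x\<bar> powr p)"
  shows "integrable unit_meas (\<lambda>x. \<bar>(1 - t) * f x + t * g x\<bar> powr p)"
    and "(\<integral>x. \<bar>(1 - t) * f x + t * g x\<bar> powr p \<partial>unit_meas) \<le>
      (1 - t) * (\<integral>x. \<bar>f x\<bar> powr p \<partial>unit_meas) + t * (\<integral>x. \<bar>g x\<bar> powr p \<partial>unit_meas)"
proof -
  have le: "\<bar>(1 - t) * f x + t * g x\<bar> powr p \<le> (1 - t) * \<bar>f x\<bar> powr p + t * \<bar>g x\<bar> powr p" for x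
  proof -
    have "\<bar>(1 - t) * f x + t * g x\<bar> \<le> (1 - t) * \<bar>f x\<bar> + t * \<bar>g x\<bar>"
      using t abs_triangle_ineq[of "(1 - t) * f x" "t * g x"] by (simp add: abs_mult)
    then have "\<bar>(1 - t) * f x + t * g x\<bar> powr p \<le> ((1 - t) * \<bar>f x\<bar> + t * \<bar>g x\<bar>) powr p"
      using p by (intro powr_mono2) auto
    also have "\<dots> \<le> (1 - t) * \<bar>f x\<bar> powr p + t * \<bar>g x\<bar> powr p"
      using p t by (intro powr_convex_nonneg) auto
    finally show ?thesis .
  qed
  have int: "integrable unit_meas (\<lambda>x. (1 - t) * \<bar>f x\<bar> powr p + t * \<bar>g x\<bar> powr p)"
    using f g by (intro Bochner_Integration.integrable_add integrable_mult_right) auto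
  show *: "integrable unit_meas (\<lambda>x. \<bar>(1 - t) * f x + t * g x\<bar> powr p)"
    by (rule Bochner_Integration.integrable_bound[OF int])
      (use f g le in \<open>auto intro!: always_eventually order_trans[OF le]\<close>)
  have "(\<integral>x. \<bar>(1 - t) * f x + t * g x\<bar> powr p \<partial>unit_meas) \<le>
      (\<integral>x. (1 - t) * \<bar>f x\<bar> powr p + t * \<bar>g x\<bar> powr p \<partial>unit_meas)"
    by (intro integral_mono * int le)
  also have "\<dots> = (1 - t) * (\<integral>x. \<bar>f x\<bar> powr p \<partial>unit_meas) + t * (\<integral>x. \<bar>g x\<bar> powr p \<partial>unit_meas)"
    using f g by simp
  finally show "(\<integral>x. \<bar>(1 - t) * f x + t * g x\<bar> powr p \<partial>unit_meas) \<le>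
      (1 - t) * (\<integral>x. \<bar>f x\<bar> powr p \<partial>unit_meas) + t * (\<integral>x. \<bar>g x\<bar> powr p \<partial>unit_meas)" .
qed

lemma Lp_norm_nonneg [simp]: "0 \<le> Lp_norm p f"
  by transfer simp

lemma Lp_norm_scaleR: "0 < p \<Longrightarrow> Lp_norm p (c *\<^sub>R f) = \<bar>c\<bar> * Lp_norm p f"
  by transfer (simp add: abs_mult powr_mult powr_powr)

lemma in_Lp_scaleR: "in_Lp p f \<Longrightarrow> in_Lp p (c *\<^sub>R f)"
  by transfer (simp add: abs_mult powr_mult)

lemma in_Lp_zero: "in_Lp p 0"
  by transfer simp

lemma Lp_norm_zero [simp]: "Lp_norm p 0 = 0"
  by transfer simp

lemma Lp_norm_powr: "0 < p \<Longrightarrow> Lp_norm p (abs_L0 f) powr p = (\<integral>x. \<bar>f x\<bar> powr p \<partial>unit_meas)"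
  if "f \<in> borel_measurable unit_meas" for f
  using that by (simp add: Lp_norm.abs_eq powr_powr integral_nonneg_AE)

lemma Lp_norm_le_iff:
  assumes "f \<in> borel_measurable unit_meas" "0 < p" "0 \<le> C"
  shows "Lp_norm p (abs_L0 f) \<le> C \<longleftrightarrow> (\<integral>x. \<bar>f x\<bar> powr p \<partial>unit_meas) \<le> C powr p"
  using powr_mono2[of p "Lp_norm p (abs_L0 f)" C]
    powr_less_mono2[of p C "Lp_norm p (abs_L0 f)"] assms
  by (force simp flip: Lp_norm_powr)

lemma Lp_lincomb:
  assumes "1 \<le> p" "0 \<le> t" "t \<le> 1" "in_Lp p f" "in_Lp p g"
  shows "in_Lp p ((1 - t) *\<^sub>R f + t *\<^sub>R g)"
    and "Lp_norm p f \<le> 1 \<Longrightarrow> Lp_norm p g \<le> 1 \<Longrightarrow> Lp_norm p ((1 - t) *\<^sub>R f + t *\<^sub>R g) \<le> 1"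
proof -
  obtain f' where f': "f' \<in> borel_measurable unit_meas" "f = abs_L0 f'" by (rule L0_cases)
  obtain g' where g': "g' \<in> borel_measurable unit_meas" "g = abs_L0 g'" by (rule L0_cases)
  have eq: "(1 - t) *\<^sub>R f + t *\<^sub>R g = abs_L0 (\<lambda>x. (1 - t) * f' x + t * g' x)"
    using f' g' by (simp add: plus_L0.abs_eq scaleR_L0.abs_eq)
  have int: "integrable unit_meas (\<lambda>x. \<bar>f' x\<bar> powr p)" "integrable unit_meas (\<lambda>x. \<bar>g' x\<bar> powr p)"
    using assms f' g' by (simp_all add: in_Lp.abs_eq)
  note * = integrable_powr_lincomb[OF assms(1-3) f'(1) int(1) g'(1) int(2)]
  show "in_Lp p ((1 - t) *\<^sub>R f + t *\<^sub>R g)"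
    unfolding eq using * f' g' by (simp add: in_Lp.abs_eq)
  assume "Lp_norm p f \<le> 1" "Lp_norm p g \<le> 1"
  then have "(\<integral>x. \<bar>f' x\<bar> powr p \<partial>unit_meas) \<le> 1" "(\<integral>x. \<bar>g' x\<bar> powr p \<partial>unit_meas) \<le> 1"
    using assms f' g' by (auto simp: Lp_norm_le_iff)
  then have "(1 - t) * (\<integral>x. \<bar>f' x\<bar> powr p \<partial>unit_meas) + t * (\<integral>x. \<bar>g' x\<bar> powr p \<partial>unit_meas) \<le> (1 - t) * 1 + t * 1"
    using assms by (intro add_mono mult_left_mono) auto
  then show "Lp_norm p ((1 - t) *\<^sub>R f + t *\<^sub>R g) \<le> 1"
    unfolding eq using * f' g' assms by (subst Lp_norm_le_iff) auto
qed

lemma in_Lp_add: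
  assumes "1 \<le> p" "in_Lp p f" "in_Lp p g"
  shows "in_Lp p (f + g)"
  using in_Lp_scaleR[OF Lp_lincomb(1)[OF assms(1) _ _ assms(2,3), of "1/2"], of 2]
  by (simp add: scaleR_add_right)

text \<open>Minkowski's inequality follows from convexity of the unit ball, applied to
  \<open>f\<close> and \<open>g\<close> divided by \<open>A\<close> and \<open>B\<close>. Taking
  these slightly above the norms avoids division by zero.\<close>

lemma Lp_norm_add:
  assumes p: "1 \<le> p" and f: "in_Lp p f" and g: "in_Lp p g"
  shows "Lp_norm p (f + g) \<le> Lp_norm p f + Lp_norm p g"
proof (rule field_le_epsilon)
  fix e :: real assume e: "0 < e"
  define A where "A = Lp_norm p f + e / 2"
  define B where "B = Lp_norm p g + e / 2"
  have A: "0 < A" "Lp_norm p f \<le> A" and B: "0 < B" "Lp_norm p g \<le> B"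
    using e by (auto simp: A_def B_def add_nonneg_pos)
  \<comment> \<open>The weight for which the convex combination of the two normalised functions is a
    multiple of \<open>f + g\<close>.\<close>
  define t where "t = B / (A + B)"
  have t: "0 \<le> t" "t \<le> 1" "(1 - t) = A / (A + B)" using A B by (auto simp: t_def field_simps)
  have "Lp_norm p ((1 - t) *\<^sub>R (1 / A) *\<^sub>R f + t *\<^sub>R (1 / B) *\<^sub>R g) \<le> 1"
    using A B p by (intro Lp_lincomb(2) p t in_Lp_scaleR f g) (auto simp: Lp_norm_scaleR)
  moreover have "(1 - t) *\<^sub>R (1 / A) *\<^sub>R f + t *\<^sub>R (1 / B) *\<^sub>R g = (1 / (A + B)) *\<^sub>R (f + g)"
    unfolding t(3) using A B by (simp add: t_def scaleR_add_right)
  ultimately have "Lp_norm p (f + g) \<le> A + B"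
    using A B p by (simp add: Lp_norm_scaleR divide_le_eq)
  then show "Lp_norm p (f + g) \<le> Lp_norm p f + Lp_norm p g + e" by (simp add: A_def B_def)
qed

lemma Lp_norm_eq_0:
  assumes "0 < p" "in_Lp p f" "Lp_norm p f = 0"
  shows "f = 0"
  using assms
proof transfer
  fix p f assume p: "0 < p" and f: "ae_eq f f" "integrable unit_meas (\<lambda>x. \<bar>f x\<bar> powr p)"
    and 0: "(\<integral>x. \<bar>f x\<bar> powr p \<partial>unit_meas) powr (1 / p) = 0"
  have "(\<integral>x. \<bar>f x\<bar> powr p \<partial>unit_meas) = 0" using 0 by simp
  then have "AE x in unit_meas. \<bar>f x\<bar> powr p = 0"
    using f by (subst (asm) integral_nonneg_eq_0_iff_AE) auto
  then show "ae_eq f (\<lambda>_. 0)" using f by (auto simp: ae_eq_def)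
qed

lemma carr_Lp [simp]: "carr (Lp p) = {f. in_Lp p f}" and nrm_Lp [simp]: "nrm (Lp p) = Lp_norm p"
  by (simp_all add: Lp_def)

lemma normed_subspace_Lp:
  assumes "1 \<le> p"
  shows "normed_subspace (Lp p)"
proof
  show "subspace (carr (Lp p))"
    using assms by (auto simp: subspace_def in_Lp_zero in_Lp_add in_Lp_scaleR)
  show "nrm (Lp p) (- f) = nrm (Lp p) f" for f
    using Lp_norm_scaleR[of p "-1" f] assms by simp
  show "f = 0" if "f \<in> carr (Lp p)" "nrm (Lp p) f = 0" for f
    using Lp_norm_eq_0[of p f] that assms by simp
qed (use assms in \<open>auto simp: Lp_norm_scaleR Lp_norm_add\<close>)

section \<open>Hoelder's inequality and inclusions between the spaces\<close>

lift_definition pairing :: "L0 \<Rightarrow> L0 \<Rightarrow> real" is "\<lambda>f g. \<integral>x. f x * g x \<partial>unit_meas"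
  unfolding ae_eq_def by (intro integral_cong_AE) (auto elim: eventually_elim2)

text \<open>Young's inequality is applied to \<open>f\<close> and \<open>g\<close> divided by
  \<open>F + e\<close> and \<open>G + e\<close>, numbers just above the norms and hence positive;
  then \<open>e\<close> tends to 0.\<close>

lemma Holder:
  fixes f g :: "real \<Rightarrow> real"
  assumes p: "1 < p" "1 < p'" "1 / p + 1 / p' = 1"
    and f: "f \<in> borel_measurable unit_meas" "integrable unit_meas (\<lambda>x. \<bar>f x\<bar> powr p)"
    and g: "g \<in> borel_measurable unit_meas" "integrable unit_meas (\<lambda>x. \<bar>g x\<bar> powr p')"
  shows "integrable unit_meas (\<lambda>x. f x * g x)"
    and "\<bar>\<integral>x. f x * g x \<partial>unit_meas\<bar> \<le> Lp_norm p (abs_L0 f) * Lp_norm p' (abs_L0 g)"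
proof -
  have young: "\<bar>f x * g x\<bar> \<le> A * B * (\<bar>f x\<bar> powr p / A powr p / p + \<bar>g x\<bar> powr p' / B powr p' / p')"
    if "0 < A" "0 < B" for A B x
    using Youngs_inequality[of p p' "\<bar>f x\<bar> / A" "\<bar>g x\<bar> / B"] p that
    by (simp add: powr_divide abs_mult field_simps)
  have int: "integrable unit_meas (\<lambda>x. A * B * (\<bar>f x\<bar> powr p / A powr p / p + \<bar>g x\<bar> powr p' / B powr p' / p'))" for A B
    using f g by (intro integrable_mult_right Bochner_Integration.integrable_add integrable_divide)
  show fg: "integrable unit_meas (\<lambda>x. f x * g x)"
  proof (rule Bochner_Integration.integrable_bound[OF int[of 1 1]])
    show "AE x in unit_meas. norm (f x * g x) \<le> norm (1 * 1 * (\<bar>f x\<bar> powr p / 1 powr p / p + \<bar>g x\<bar> powr p' / 1 powr p' / p'))"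
      using young[of 1 1] unfolding real_norm_def
      by (intro always_eventually allI order_trans[OF _ abs_ge_self]) simp
  qed (use f g in auto)
  define F where "F = Lp_norm p (abs_L0 f)"
  define G where "G = Lp_norm p' (abs_L0 g)"
  have "\<bar>\<integral>x. f x * g x \<partial>unit_meas\<bar> \<le> (F + e) * (G + e)" if e: "0 < e" for e
  proof -
    let ?A = "F + e" and ?B = "G + e"
    have AB: "0 < ?A" "0 < ?B" using e by (auto simp: F_def G_def add_nonneg_pos)
    have "(\<integral>x. \<bar>f x\<bar> powr p \<partial>unit_meas) \<le> ?A powr p" "(\<integral>x. \<bar>g x\<bar> powr p' \<partial>unit_meas) \<le> ?B powr p'"
      using p f g e AB Lp_norm_le_iff[of f p ?A] Lp_norm_le_iff[of g p' ?B] by (auto simp: F_def G_def)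
    then have 1: "(\<integral>x. \<bar>f x\<bar> powr p \<partial>unit_meas) / ?A powr p / p \<le> 1 / p"
      "(\<integral>x. \<bar>g x\<bar> powr p' \<partial>unit_meas) / ?B powr p' / p' \<le> 1 / p'"
      using p AB by (auto intro!: divide_right_mono simp: divide_le_eq)
    have "\<bar>\<integral>x. f x * g x \<partial>unit_meas\<bar> \<le> (\<integral>x. \<bar>f x * g x\<bar> \<partial>unit_meas)"
      by (rule integral_abs_bound)
    also have "\<dots> \<le> (\<integral>x. ?A * ?B * (\<bar>f x\<bar> powr p / ?A powr p / p + \<bar>g x\<bar> powr p' / ?B powr p' / p') \<partial>unit_meas)"
      by (intro integral_mono int young AB integrable_abs fg)
    also have "\<dots> = ?A * ?B * ((\<integral>x. \<bar>f x\<bar> powr p \<partial>unit_meas) / ?A powr p / p + (\<integral>x. \<bar>g x\<bar> powr p' \<partial>unit_meas) / ?B powr p' / p')"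
      using f g by simp
    also have "\<dots> \<le> ?A * ?B * (1 / p + 1 / p')"
      using AB by (intro mult_left_mono add_mono 1) auto
    finally show ?thesis using p by simp
  qed
  then have "\<forall>\<^sub>F e in at_right 0. \<bar>\<integral>x. f x * g x \<partial>unit_meas\<bar> \<le> (F + e) * (G + e)"
    by (auto simp: eventually_at_right_less eventually_at_filter intro!: always_eventually)
  moreover have "((\<lambda>e. (F + e) * (G + e)) \<longlongrightarrow> (F + 0) * (G + 0)) (at_right 0)"
    by (intro tendsto_intros)
  ultimately show "\<bar>\<integral>x. f x * g x \<partial>unit_meas\<bar> \<le> F * G"
    using tendsto_lowerbound[of "\<lambda>e. (F + e) * (G + e)" "F * G" "at_right 0"] by simp
qed

text \<open>Hoelder's inequality against the constant 1, whose norm is 1 because the interval has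
  measure 1.\<close>

lemma Lp_subset:
  assumes "1 < p" "in_Lp p f"
  shows "in_Lp 1 f" "Lp_norm 1 f \<le> Lp_norm p f"
proof -
  obtain f' where f': "f' \<in> borel_measurable unit_meas" "f = abs_L0 f'" by (rule L0_cases)
  define q where "q = p / (p - 1)"
  have q: "1 < q" "1 / p + 1 / q = 1" using assms(1) by (auto simp: q_def field_simps)
  note H = Holder[OF assms(1) q, of "\<lambda>x. \<bar>f' x\<bar>" "\<lambda>_. 1"]
  have int: "integrable unit_meas (\<lambda>x. \<bar>f' x\<bar> powr p)" using assms f' by (simp add: in_Lp.abs_eq)
  show "in_Lp 1 f" using H(1) f' int by (simp add: in_Lp.abs_eq)
  have "Lp_norm p (abs_L0 (\<lambda>x. \<bar>f' x\<bar>)) = Lp_norm p f" "Lp_norm q (abs_L0 (\<lambda>x. 1)) = 1"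
    using f' by (simp_all add: Lp_norm.abs_eq)
  then show "Lp_norm 1 f \<le> Lp_norm p f" using H(2) f' int
    by (simp add: Lp_norm.abs_eq)
qed

text \<open>Every nonnegative essential bound dominates the \<open>L\<^sub>p\<close> norm, hence so
  does their infimum.\<close>

lemma in_LinfD:
  assumes "0 < p" "f \<in> carr Linf"
  shows "in_Lp p f" "Lp_norm p f \<le> nrm Linf f"
proof -
  obtain f' where f': "f' \<in> borel_measurable unit_meas" "f = abs_L0 f'" by (rule L0_cases)
  have *: "in_Lp p f \<and> Lp_norm p f \<le> C" if C: "0 \<le> C" "ess_bound f C" for C
  proof -
    have AE: "AE x in unit_meas. \<bar>f' x\<bar> \<le> C" using C f' by (simp add: ess_bound.abs_eq)
    then have AE': "AE x in unit_meas. \<bar>f' x\<bar> powr p \<le> C powr p"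
      by eventually_elim (use assms(1) in \<open>auto intro: powr_mono2\<close>)
    then have int: "integrable unit_meas (\<lambda>x. \<bar>f' x\<bar> powr p)"
      using f' by (intro unit_meas.integrable_const_bound[where B = "C powr p"]) auto
    then have "(\<integral>x. \<bar>f' x\<bar> powr p \<partial>unit_meas) \<le> (\<integral>x. C powr p \<partial>unit_meas)"
      using AE' by (intro integral_mono_AE) auto
    then show ?thesis using int f' C assms(1)
      by (simp add: in_Lp.abs_eq Lp_norm_le_iff)
  qed
  obtain C where "ess_bound f C" using assms(2) by (auto simp: Linf_def)
  then have "ess_bound f \<bar>C\<bar>"
    using f' by (auto simp: ess_bound.abs_eq elim: eventually_mono)
  then show "in_Lp p f" "Lp_norm p f \<le> nrm Linf f"
    using *[of "\<bar>C\<bar>"] * by (auto simp: Linf_def intro!: cInf_greatest)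
qed

section \<open>Completeness\<close>

lemma (in normed_subspace) complete_limit:
  assumes "metric.mcomplete" "\<And>n. s n \<in> carr X"
    and "\<And>e. 0 < e \<Longrightarrow> \<exists>M. \<forall>m\<ge>M. \<forall>n\<ge>m. nrm X (s n - s m) < e"
  shows "\<exists>x\<in>carr X. (\<lambda>n. nrm X (x - s n)) \<longlonglongrightarrow> 0"
proof -
  have "metric.MCauchy s"
    unfolding metric.MCauchy_def
  proof (intro conjI allI impI)
    fix e :: real assume "0 < e"
    then obtain M where M: "\<And>m n. M \<le> m \<Longrightarrow> m \<le> n \<Longrightarrow> nrm X (s n - s m) < e" using assms(3) by blast
    have "nrm X (s m - s n) < e" if "M \<le> m" "M \<le> n" for m n
    proof (cases "m \<le> n")
      case True
      then show ?thesis using M[OF that(1) True] by (subst nrm_minus_commute)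
    qed (use M[of n m] that in simp)
    then show "\<exists>N. \<forall>m n. N \<le> m \<longrightarrow> N \<le> n \<longrightarrow> nrm X (s m - s n) < e" by blast
  qed (use assms(2) in auto)
  then obtain x where "limitin metric.mtopology s x sequentially"
    using assms(1) unfolding metric.mcomplete_def by blast
  then have "x \<in> carr X" "(\<lambda>n. nrm X (s n - x)) \<longlonglongrightarrow> 0"
    by (simp_all add: metric.limitin_metric_dist_null)
  then show ?thesis by (intro bexI[of _ x]) (simp_all add: nrm_minus_commute[of x])
qed

text \<open>The Riesz-Fischer argument: the increments are summable in \<open>L\<^sub>1\<close>, so
  the sequence converges almost everywhere, and Fatou's lemma carries the distance estimates to the
  limit.\<close>

lemma Lp_limit_of_fast_Cauchy:
  assumes p: "1 < p" and G: "\<And>k. G k \<in> borel_measurable unit_meas"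
    and in_Lp: "\<And>k. in_Lp p (abs_L0 (G k))"
    and fast: "\<And>k m. k \<le> m \<Longrightarrow> Lp_norm p (abs_L0 (G m) - abs_L0 (G k)) \<le> (1/2) ^ k"
  shows "\<exists>f. in_Lp p f \<and> (\<forall>k. Lp_norm p (f - abs_L0 (G k)) \<le> (1/2) ^ k)"
proof -
  interpret X: normed_subspace "Lp p" using p by (intro normed_subspace_Lp) simp
  have diff: "abs_L0 f - abs_L0 g = abs_L0 (\<lambda>x. f x - g x)"
    if "f \<in> borel_measurable unit_meas" "g \<in> borel_measurable unit_meas" for f g
    using that by (simp add: minus_L0.abs_eq)
  have inL: "in_Lp p (abs_L0 (\<lambda>x. G m x - G k x))" for m k
    using X.carr_diff[of "abs_L0 (G m)" "abs_L0 (G k)"] in_Lp G by (simp add: diff)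
  have nL: "Lp_norm p (abs_L0 (\<lambda>x. G m x - G k x)) \<le> (1/2) ^ k" if "k \<le> m" for m k
    using fast[OF that] G by (simp add: diff)
  have "(\<integral>\<^sup>+x. ennreal \<bar>G (Suc k) x - G k x\<bar> \<partial>unit_meas) \<le> ennreal ((1/2) ^ k)" for k
  proof -
    have "in_Lp 1 (abs_L0 (\<lambda>x. G (Suc k) x - G k x))"
      "Lp_norm 1 (abs_L0 (\<lambda>x. G (Suc k) x - G k x)) \<le> (1/2) ^ k"
      using Lp_subset[OF p inL[of "Suc k" k]] nL[of k "Suc k"] by auto
    then show ?thesis
      using G by (subst nn_integral_eq_integral) (auto simp: in_Lp.abs_eq Lp_norm.abs_eq intro!: ennreal_leI)
  qed
  then have "(\<Sum>k. \<integral>\<^sup>+x. ennreal \<bar>G (Suc k) x - G k x\<bar> \<partial>unit_meas) \<le> (\<Sum>k. ennreal ((1/2) ^ k))"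
    by (intro suminf_le) auto
  also have "\<dots> < \<infinity>"
    by (subst suminf_ennreal2) (auto intro: summable_geometric)
  finally have "(\<integral>\<^sup>+x. (\<Sum>k. ennreal \<bar>G (Suc k) x - G k x\<bar>) \<partial>unit_meas) \<noteq> \<infinity>"
    using G by (subst nn_integral_suminf) auto
  then have "AE x in unit_meas. (\<Sum>k. ennreal \<bar>G (Suc k) x - G k x\<bar>) \<noteq> \<infinity>"
    using G by (intro nn_integral_noteq_infinite) auto
  then have conv: "AE x in unit_meas. (\<lambda>k. G k x) \<longlonglongrightarrow> lim (\<lambda>k. G k x)"
  proof eventually_elim
    case (elim x)
    then have "summable (\<lambda>k. \<bar>G (Suc k) x - G k x\<bar>)"
      by (intro summable_suminf_not_top) auto
    then have "summable (\<lambda>k. G (Suc k) x - G k x)" by (rule summable_rabs_cancel)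
    then have "convergent (\<lambda>n. \<Sum>k<n. G (Suc k) x - G k x)" by (simp add: summable_iff_convergent)
    then have "convergent (\<lambda>n. (\<Sum>k<n. G (Suc k) x - G k x) + G 0 x)"
      by (intro convergent_add convergent_const)
    then have "convergent (\<lambda>n. G n x)"
      unfolding sum_lessThan_telescope[of "\<lambda>k. G k x"] by simp
    then show ?case by (simp add: convergent_LIMSEQ_iff)
  qed
  define u where "u = (\<lambda>x. lim (\<lambda>k. G k x))"
  have u: "u \<in> borel_measurable unit_meas"
    unfolding u_def using G by (intro borel_measurable_lim_metric)
  have main: "in_Lp p (abs_L0 (\<lambda>x. u x - G k x)) \<and> Lp_norm p (abs_L0 (\<lambda>x. u x - G k x)) \<le> (1/2) ^ k" for k
  proof -
    have AE: "AE x in unit_meas. ennreal (\<bar>u x - G k x\<bar> powr p) = liminf (\<lambda>m. ennreal (\<bar>G m x - G k x\<bar> powr p))"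
      using conv
    proof eventually_elim
      case (elim x)
      then have "(\<lambda>m. ennreal (\<bar>G m x - G k x\<bar> powr p)) \<longlonglongrightarrow> ennreal (\<bar>u x - G k x\<bar> powr p)"
        unfolding u_def using p by (intro tendsto_intros tendsto_powr') auto
      then show ?case by (intro lim_imp_Liminf[symmetric]) auto
    qed
    have "(\<integral>\<^sup>+x. ennreal (\<bar>G m x - G k x\<bar> powr p) \<partial>unit_meas) \<le> ennreal (((1/2) ^ k) powr p)" if "k \<le> m" for m
      using nL[OF that] inL[of m k] G p
      by (subst nn_integral_eq_integral) (auto simp: in_Lp.abs_eq Lp_norm_le_iff intro!: ennreal_leI)
    then have L: "liminf (\<lambda>m. \<integral>\<^sup>+x. ennreal (\<bar>G m x - G k x\<bar> powr p) \<partial>unit_meas) \<le> ennreal (((1/2) ^ k) powr p)"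
      by (intro Liminf_le) (auto simp: eventually_sequentially)
    have "(\<integral>\<^sup>+x. ennreal (\<bar>u x - G k x\<bar> powr p) \<partial>unit_meas)
        = (\<integral>\<^sup>+x. liminf (\<lambda>m. ennreal (\<bar>G m x - G k x\<bar> powr p)) \<partial>unit_meas)"
      by (intro nn_integral_cong_AE AE)
    also have "\<dots> \<le> liminf (\<lambda>m. \<integral>\<^sup>+x. ennreal (\<bar>G m x - G k x\<bar> powr p) \<partial>unit_meas)"
      using G by (intro nn_integral_liminf) auto
    also note L
    finally have le: "(\<integral>\<^sup>+x. ennreal (\<bar>u x - G k x\<bar> powr p) \<partial>unit_meas) \<le> ennreal (((1/2) ^ k) powr p)" .
    then have int: "integrable unit_meas (\<lambda>x. \<bar>u x - G k x\<bar> powr p)"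
      using u G by (intro integrableI_bounded) (auto intro: le_less_trans)
    then have "(\<integral>x. \<bar>u x - G k x\<bar> powr p \<partial>unit_meas) \<le> ((1/2) ^ k) powr p"
      using le by (subst (asm) nn_integral_eq_integral) auto
    then show ?thesis using int u G p by (auto simp: in_Lp.abs_eq Lp_norm_le_iff)
  qed
  have "in_Lp p (abs_L0 u)"
    using X.carr_add[of "abs_L0 (\<lambda>x. u x - G 0 x)" "abs_L0 (G 0)"] main[of 0] in_Lp[of 0] u G
    by (simp add: plus_L0.abs_eq)
  then show ?thesis using main u G by (intro exI[of _ "abs_L0 u"]) (simp add: diff)
qed

text \<open>A Cauchy sequence converges once a subsequence does, and one whose distances shrink
  geometrically can be extracted.\<close>

lemma mcomplete_Lp:
  assumes p: "1 < p"
  shows "Metric_space.mcomplete (carr (Lp p)) (\<lambda>x y. nrm (Lp p) (x - y))"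
proof -
  interpret X: normed_subspace "Lp p" using p by (intro normed_subspace_Lp) simp
  show ?thesis
    unfolding X.metric.mcomplete_def
  proof (intro allI impI)
    fix \<sigma> assume "X.metric.MCauchy \<sigma>"
    then have \<sigma>: "\<And>n. in_Lp p (\<sigma> n)"
      and C: "\<And>\<epsilon>. 0 < \<epsilon> \<Longrightarrow> \<exists>N. \<forall>n n'. N \<le> n \<longrightarrow> N \<le> n' \<longrightarrow> Lp_norm p (\<sigma> n - \<sigma> n') < \<epsilon>"
      unfolding X.metric.MCauchy_def by auto
    have "\<forall>k. \<exists>N. \<forall>n n'. N \<le> n \<longrightarrow> N \<le> n' \<longrightarrow> Lp_norm p (\<sigma> n - \<sigma> n') < (1/2) ^ k"
      by (intro allI C) simp
    then obtain \<psi> where \<psi>: "\<And>k n n'. \<psi> k \<le> n \<Longrightarrow> \<psi> k \<le> n' \<Longrightarrow> Lp_norm p (\<sigma> n - \<sigma> n') < (1/2) ^ k"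
      by metis
    \<comment> \<open>Summing the thresholds makes the indices monotone in \<open>k\<close> and
      keeps each at or above its threshold.\<close>
    define r where "r k = (\<Sum>j\<le>k. \<psi> j)" for k
    have r: "\<psi> k \<le> r k" for k unfolding r_def by (rule member_le_sum) auto
    have r_mono: "r k \<le> r m" if "k \<le> m" for k m
      unfolding r_def using that by (intro sum_mono2) auto
    have "\<forall>k. \<exists>g. g \<in> borel_measurable unit_meas \<and> \<sigma> (r k) = abs_L0 g" by (metis L0_cases)
    then obtain G where G: "\<And>k. G k \<in> borel_measurable unit_meas" "\<And>k. \<sigma> (r k) = abs_L0 (G k)"
      by metis
    have "\<exists>f. in_Lp p f \<and> (\<forall>k. Lp_norm p (f - abs_L0 (G k)) \<le> (1/2) ^ k)"
    proof (rule Lp_limit_of_fast_Cauchy[OF p G(1)])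
      show "in_Lp p (abs_L0 (G k))" for k using \<sigma>[of "r k"] G by simp
      show "Lp_norm p (abs_L0 (G m) - abs_L0 (G k)) \<le> (1/2) ^ k" if "k \<le> m" for k m
        using \<psi>[of k "r m" "r k"] r[of k] r_mono[OF that] by (simp add: G(2)[symmetric])
    qed
    then obtain f where f: "in_Lp p f" "\<And>k. Lp_norm p (f - \<sigma> (r k)) \<le> (1/2) ^ k"
      by (auto simp: G(2))
    have "\<exists>N. \<forall>n\<ge>N. Lp_norm p (\<sigma> n - f) < e" if e: "0 < e" for e
    proof -
      obtain k where k: "(1/2) ^ k < e / 2" using real_arch_pow_inv[of "e/2" "1/2"] e by auto
      have "Lp_norm p (\<sigma> n - f) < e" if n: "r k \<le> n" for n
      proof -
        have "Lp_norm p (\<sigma> n - f) \<le> Lp_norm p (\<sigma> n - \<sigma> (r k)) + Lp_norm p (\<sigma> (r k) - f)"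
          using X.nrm_triangle[of "\<sigma> n" "\<sigma> (r k)" f] \<sigma> f(1) by simp
        also have "\<dots> < (1/2) ^ k + (1/2) ^ k"
          using \<psi>[of k n "r k"] r[of k] n f(2)[of k] X.nrm_minus_commute[of "\<sigma> (r k)" f]
          by (intro add_less_le_mono) auto
        also have "\<dots> < e" using k by simp
        finally show ?thesis .
      qed
      then show ?thesis by blast
    qed
    then have "limitin X.metric.mtopology \<sigma> f sequentially"
      using f(1) \<sigma> unfolding X.metric.limit_metric_sequentially by auto
    then show "\<exists>x. limitin X.metric.mtopology \<sigma> x sequentially" ..
  qed
qed

subsection \<open>Rademacher functions\<close>

lemma integral_unit_meas:
  fixes H :: "real \<Rightarrow> real"
  assumes "H \<in> borel_measurable borel"
  shows "(\<integral>x. H x \<partial>unit_meas) = (\<integral>x. indicator {0<..<1} x * H x \<partial>lborel)"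
proof -
  have "(\<integral>x. H x \<partial>unit_meas) = (\<integral>x. indicator {0<..<1} x *\<^sub>R H x \<partial>lebesgue)"
    by (intro integral_restrict_space) auto
  also have "\<dots> = (\<integral>x. indicator {0<..<1} x *\<^sub>R H x \<partial>lborel)"
    using assms by (intro integral_completion) auto
  finally show ?thesis by simp
qed

text \<open>Cut at 1/2 and rescale each half to the whole interval. With the self-similarity of the
  Rademacher functions this turns integrals into recursions, which take the place of
  independence.\<close>

lemma integral_unit_meas_halves:
  fixes H :: "real \<Rightarrow> real"
  assumes H: "H \<in> borel_measurable borel" and B: "\<And>x. \<bar>H x\<bar> \<le> B"
  shows "(\<integral>x. H x \<partial>unit_meas) =
    ((\<integral>x. H (x / 2) \<partial>unit_meas) + (\<integral>x. H ((1 + x) / 2) \<partial>unit_meas)) / 2"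
proof -
  have int: "integrable lborel (\<lambda>x. indicator {a<..<b} x * H x)" for a b
    using integrableI_bounded_set_indicator[of "{a<..<b}" lborel H B] H B
    by (cases "a \<le> b") (auto intro!: always_eventually)
  have "(\<integral>x. H x \<partial>unit_meas) = (\<integral>x. indicator {0<..<1} x * H x \<partial>lborel)"
    by (rule integral_unit_meas[OF H])
  also have "\<dots> = (\<integral>x. indicator {0<..<1/2} x * H x + indicator {1/2<..<1} x * H x \<partial>lborel)"
  proof (rule integral_cong_AE)
    have "AE x in lborel. x \<noteq> (1/2 :: real)" by (rule AE_lborel_singleton)
    then show "AE x in lborel. indicator {0<..<1} x * H x =
        indicator {0<..<1/2} x * H x + indicator {1/2<..<1} x * H x"
      by eventually_elim (auto simp: indicator_def)
  qed (use H in auto)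
  also have "\<dots> = (\<integral>x. indicator {0<..<1/2} x * H x \<partial>lborel) + (\<integral>x. indicator {1/2<..<1} x * H x \<partial>lborel)"
    by (intro Bochner_Integration.integral_add int)
  also have "(\<integral>x. indicator {0<..<1/2} x * H x \<partial>lborel) = (\<integral>x. indicator {0<..<1} x * H (x / 2) \<partial>lborel) / 2"
    by (subst lborel_integral_real_affine[of "1/2" _ 0])
      (auto simp: indicator_def intro!: Bochner_Integration.integral_cong)
  also have "(\<integral>x. indicator {1/2<..<1} x * H x \<partial>lborel) = (\<integral>x. indicator {0<..<1} x * H ((1 + x) / 2) \<partial>lborel) / 2"
    by (subst lborel_integral_real_affine[of "1/2" _ "1/2"])
      (auto simp: indicator_def add_divide_distrib intro!: Bochner_Integration.integral_cong)
  finally show ?thesis using H by (simp add: integral_unit_meas)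
qed

text \<open>The sign given by the binary digit number \<open>n + 1\<close> of \<open>x\<close>;
  owing to \<open>Suc n\<close> in the exponent, \<open>rademacher 0\<close> already separates the
  two halves of the interval.\<close>

definition rademacher :: "nat \<Rightarrow> real \<Rightarrow> real" where
  "rademacher n x = (if even \<lfloor>2 ^ Suc n * x\<rfloor> then 1 else -1)"

lemma borel_measurable_rademacher [measurable]: "rademacher n \<in> borel_measurable borel"
  unfolding rademacher_def by measurable

lemma abs_rademacher [simp]: "\<bar>rademacher n x\<bar> = 1"
  by (simp add: rademacher_def)

lemma rademacher_0_half:
  assumes "x \<in> {0<..<1}"
  shows "rademacher 0 (x / 2) = 1" "rademacher 0 ((1 + x) / 2) = -1"
proof -
  have 0: "2 ^ Suc 0 * (x / 2) = x" "2 ^ Suc 0 * ((1 + x) / 2) = 1 + x" by simp_all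
  have "\<lfloor>x\<rfloor> = 0" "\<lfloor>1 + x\<rfloor> = 1" using assms by (auto simp: floor_eq_iff)
  then show "rademacher 0 (x / 2) = 1" "rademacher 0 ((1 + x) / 2) = -1"
    unfolding rademacher_def 0 by simp_all
qed

lemma rademacher_Suc_half: "rademacher (Suc n) (x / 2) = rademacher n x"
proof -
  have "2 ^ Suc (Suc n) * (x / 2) = 2 ^ Suc n * x" by simp
  then show ?thesis unfolding rademacher_def by metis
qed

lemma rademacher_periodic: "rademacher n (1 + x) = rademacher n x"
proof -
  have "2 ^ Suc n * (1 + x) = 2 ^ Suc n * x + of_int (2 ^ Suc n)"
    by (simp add: algebra_simps)
  then have "\<lfloor>2 ^ Suc n * (1 + x)\<rfloor> = \<lfloor>2 ^ Suc n * x\<rfloor> + 2 ^ Suc n"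
    by (metis floor_add_int)
  then show ?thesis
    by (simp add: rademacher_def)
qed

text \<open>Under the two rescalings the first function becomes constant, with opposite signs, and
  each later one becomes its predecessor.\<close>

lemmas rademacher_halves = rademacher_0_half rademacher_Suc_half rademacher_periodic

lemma integral_unit_meas_cong:
  fixes f g :: "real \<Rightarrow> real"
  shows "(\<And>x. x \<in> {0<..<1} \<Longrightarrow> f x = g x) \<Longrightarrow> (\<integral>x. f x \<partial>unit_meas) = (\<integral>x. g x \<partial>unit_meas)"
  by (intro Bochner_Integration.integral_cong) (auto simp: space_unit_meas)

text \<open>For \<open>m = 0\<close> the two halves contribute opposite integrals; otherwise
  rescaling lowers both indices by one.\<close>

lemma integral_rademacher_orthogonal:
  "m < n \<Longrightarrow> (\<integral>x. rademacher m x * rademacher n x \<partial>unit_meas) = 0"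
proof (induction m arbitrary: n)
  case 0
  then obtain k where n: "n = Suc k" by (cases n) auto
  let ?H = "\<lambda>x. rademacher 0 x * rademacher n x"
  have "(\<integral>x. ?H x \<partial>unit_meas) = ((\<integral>x. ?H (x / 2) \<partial>unit_meas) + (\<integral>x. ?H ((1 + x) / 2) \<partial>unit_meas)) / 2"
    by (intro integral_unit_meas_halves[where B = 1]) (auto simp: abs_mult)
  also have "(\<integral>x. ?H (x / 2) \<partial>unit_meas) = (\<integral>x. rademacher k x \<partial>unit_meas)"
    by (intro integral_unit_meas_cong) (auto simp: n rademacher_halves)
  also have "(\<integral>x. ?H ((1 + x) / 2) \<partial>unit_meas) = (\<integral>x. - rademacher k x \<partial>unit_meas)"
    by (intro integral_unit_meas_cong) (auto simp: n rademacher_halves)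
  finally have "(\<integral>x. ?H x \<partial>unit_meas) = 0" by simp
  then show ?case by simp
next
  case (Suc m)
  then obtain k where n: "n = Suc k" by (cases n) auto
  have "(\<integral>x. rademacher (Suc m) x * rademacher n x \<partial>unit_meas) = (\<integral>x. rademacher m x * rademacher k x \<partial>unit_meas)"
    by (subst integral_unit_meas_halves[where B = 1]) (auto simp: n abs_mult rademacher_halves)
  then show ?case using Suc n by simp
qed

text \<open>On the two halves the first term contributes \<open>exp (t 0)\<close> and
  \<open>exp (- t 0)\<close>, whose mean is \<open>cosh (t 0)\<close>; what is left is the same
  integral for the shifted coefficients, hence the induction over arbitrary
  \<open>t\<close>.\<close>

lemma integral_exp_rademacher:
  "(\<integral>x. exp (\<Sum>n<N. t n * rademacher n x) \<partial>unit_meas) = (\<Prod>n<N. cosh (t n :: real))"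
proof (induction N arbitrary: t)
  case 0
  then show ?case by (simp add: space_unit_meas)
next
  case (Suc N)
  let ?H = "\<lambda>x. exp (\<Sum>n<Suc N. t n * rademacher n x)"
  let ?K = "\<lambda>x. exp (\<Sum>n<N. t (Suc n) * rademacher n x)"
  have "\<bar>?H x\<bar> \<le> exp (\<Sum>n<Suc N. \<bar>t n\<bar>)" for x
  proof -
    have "t n * rademacher n x \<le> \<bar>t n\<bar>" for n
      using abs_ge_self[of "t n * rademacher n x"] by (simp add: abs_mult)
    then show ?thesis by (simp add: sum_mono del: sum.lessThan_Suc)
  qed
  then have "(\<integral>x. ?H x \<partial>unit_meas) = ((\<integral>x. ?H (x / 2) \<partial>unit_meas) + (\<integral>x. ?H ((1 + x) / 2) \<partial>unit_meas)) / 2"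
    by (intro integral_unit_meas_halves) auto
  also have "(\<integral>x. ?H (x / 2) \<partial>unit_meas) = (\<integral>x. exp (t 0) * ?K x \<partial>unit_meas)"
    by (intro integral_unit_meas_cong)
      (simp only: sum.lessThan_Suc_shift rademacher_halves, simp add: exp_add exp_diff exp_minus divide_inverse)
  also have "(\<integral>x. ?H ((1 + x) / 2) \<partial>unit_meas) = (\<integral>x. exp (- t 0) * ?K x \<partial>unit_meas)"
    by (intro integral_unit_meas_cong)
      (simp only: sum.lessThan_Suc_shift rademacher_halves, simp add: exp_add exp_diff exp_minus divide_inverse)
  also have "((\<integral>x. exp (t 0) * ?K x \<partial>unit_meas) + (\<integral>x. exp (- t 0) * ?K x \<partial>unit_meas)) / 2 =
      cosh (t 0) * (\<integral>x. ?K x \<partial>unit_meas)"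
    by (simp add: cosh_def algebra_simps add_divide_distrib)
  also have "(\<integral>x. ?K x \<partial>unit_meas) = (\<Prod>n<N. cosh (t (Suc n)))" by (rule Suc.IH)
  finally show ?case by (simp only: prod.lessThan_Suc_shift)
qed

section \<open>Khintchine's inequality\<close>

text \<open>For \<open>y\<close> in the unit interval \<open>exp y \<le> 1 + y + y\<^sup>2\<close>
  and \<open>exp (- y) \<le> 1 - y + y\<^sup>2\<close>, with mean \<open>1 + y\<^sup>2\<close>. The
  bound makes a product of \<open>cosh\<close> factors depend on the sum of squares only.\<close>

lemma cosh_le_exp_square:
  fixes x :: real
  assumes "\<bar>x\<bar> \<le> 1"
  shows "cosh x \<le> exp (x\<^sup>2)"
proof -
  have *: "cosh y \<le> 1 + y\<^sup>2" if y: "0 \<le> y" "y \<le> 1" for y :: real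
  proof -
    have up: "exp y \<le> 1 + y + y\<^sup>2" by (rule exp_bound[OF y])
    \<comment> \<open>This bounds \<open>exp (- y)\<close> from above through its reciprocal, which
      is at least the quadratic Taylor polynomial.\<close>
    have "1 \<le> (1 - y + y\<^sup>2) * (1 + y + y\<^sup>2 / 2)"
    proof -
      have "(1 - y + y\<^sup>2) * (1 + y + y\<^sup>2 / 2) = 1 + y\<^sup>2 / 2 + y ^ 3 / 2 + y ^ 4 / 2"
        by (simp add: field_simps power2_eq_square power3_eq_cube power4_eq_xxxx)
      then show ?thesis using y by simp
    qed
    also have "\<dots> \<le> (1 - y + y\<^sup>2) * exp y"
      using exp_lower_Taylor_quadratic[OF y(1)] y by (intro mult_left_mono) auto
    finally have "exp (- y) \<le> 1 - y + y\<^sup>2" by (simp add: exp_minus field_simps)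
    then show ?thesis using up by (simp add: cosh_def)
  qed
  have "cosh x = cosh \<bar>x\<bar>" by (simp add: abs_if)
  also have "\<dots> \<le> 1 + \<bar>x\<bar>\<^sup>2" using assms by (intro *) auto
  also have "\<dots> \<le> exp (x\<^sup>2)" by simp
  finally show ?thesis .
qed

text \<open>The estimate \<open>z \<le> exp z\<close> at \<open>z = \<bar>y\<bar> / q\<close>,
  raised to the power \<open>q\<close>. It trades a moment for exponentials whose integrals are
  known.\<close>

lemma powr_le_exp:
  fixes y q :: real
  assumes "0 < q"
  shows "\<bar>y\<bar> powr q \<le> q powr q * (exp y + exp (- y))"
proof -
  have "\<bar>y\<bar> / q \<le> exp (\<bar>y\<bar> / q)" using exp_ge_add_one_self[of "\<bar>y\<bar> / q"] by linarith
  then have "(\<bar>y\<bar> / q) powr q \<le> exp (\<bar>y\<bar> / q) powr q" using assms by (intro powr_mono2) auto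
  also have "exp (\<bar>y\<bar> / q) powr q = exp \<bar>y\<bar>" using assms by (simp add: powr_def)
  finally have "\<bar>y\<bar> powr q \<le> q powr q * exp \<bar>y\<bar>"
    using assms by (simp add: powr_divide divide_le_eq mult.commute)
  also have "exp \<bar>y\<bar> \<le> exp y + exp (- y)" by (simp add: abs_if)
  finally show ?thesis by (simp add: mult_left_mono)
qed

text \<open>Khintchine's inequality, from the moment generating function of a Rademacher sum.\<close>

lemma integral_rademacher_sum_powr_le:
  fixes t :: "nat \<Rightarrow> real"
  assumes q: "0 < q"
  shows "(\<integral>x. \<bar>\<Sum>n<N. t n * rademacher n x\<bar> powr q \<partial>unit_meas) \<le>
    2 * q powr q * exp 1 * (\<Sum>n<N. (t n)\<^sup>2) powr (q / 2)"
proof (cases "(\<Sum>n<N. (t n)\<^sup>2) = 0")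
  case True
  then have "t n = 0" if "n < N" for n using that by (simp add: sum_nonneg_eq_0_iff)
  then have "(\<Sum>n<N. t n * rademacher n x) = 0" for x by simp
  then show ?thesis by simp
next
  case False
  \<comment> \<open>Dividing by \<open>s\<close> makes the sum of squares 1 and every coefficient at
    most 1 in modulus, which is where the bound for \<open>cosh\<close> holds.\<close>
  define s where "s = sqrt (\<Sum>n<N. (t n)\<^sup>2)"
  have s: "0 < s" "s\<^sup>2 = (\<Sum>n<N. (t n)\<^sup>2)"
    using False by (auto simp: s_def sum_nonneg order_less_le)
  define y where "y = (\<lambda>x. \<Sum>n<N. (t n / s) * rademacher n x)"
  have meas: "y \<in> borel_measurable borel" unfolding y_def by measurable
  have bound: "\<bar>y x\<bar> \<le> (\<Sum>n<N. \<bar>t n / s\<bar>)" for x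
  proof -
    have "\<bar>y x\<bar> \<le> (\<Sum>n<N. \<bar>(t n / s) * rademacher n x\<bar>)" unfolding y_def by (rule sum_abs)
    then show ?thesis by (simp add: abs_mult)
  qed
  have int: "integrable unit_meas (\<lambda>x. exp (c * y x))" if "\<bar>c\<bar> = 1" for c
  proof (rule unit_meas.integrable_const_bound[where B = "exp (\<Sum>n<N. \<bar>t n / s\<bar>)"])
    have "c * y x \<le> (\<Sum>n<N. \<bar>t n / s\<bar>)" for x
      using bound[of x] that abs_mult[of c "y x"] by auto
    then show "AE x in unit_meas. norm (exp (c * y x)) \<le> exp (\<Sum>n<N. \<bar>t n / s\<bar>)" by simp
  qed (use meas in \<open>auto intro!: borel_measurable_unit_meas\<close>)
  have ts: "\<bar>t n / s\<bar> \<le> 1" if "n < N" for n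
  proof -
    have "(t n)\<^sup>2 \<le> s\<^sup>2" unfolding s(2) using that by (intro member_le_sum) auto
    then show ?thesis using s(1) by (simp add: abs_le_square_iff[symmetric])
  qed
  have "(\<Prod>n<N. cosh (t n / s)) \<le> (\<Prod>n<N. exp ((t n / s)\<^sup>2))"
    using ts by (intro prod_mono) (auto intro: cosh_le_exp_square)
  also have "\<dots> = exp (\<Sum>n<N. (t n / s)\<^sup>2)" by (simp add: exp_sum)
  also have "(\<Sum>n<N. (t n / s)\<^sup>2) = 1"
    using False s by (simp add: power_divide sum_divide_distrib[symmetric])
  finally have prod: "(\<Prod>n<N. cosh (t n / s)) \<le> exp 1" .
  have 1: "(\<integral>x. exp (1 * y x) \<partial>unit_meas) = (\<Prod>n<N. cosh (t n / s))"
    unfolding y_def using integral_exp_rademacher[of "\<lambda>n. t n / s" N] by simp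
  have 2: "(\<integral>x. exp (- 1 * y x) \<partial>unit_meas) = (\<Prod>n<N. cosh (t n / s))"
    unfolding y_def using integral_exp_rademacher[of "\<lambda>n. - (t n / s)" N] by (simp add: sum_negf)
  have "(\<integral>x. \<bar>y x\<bar> powr q \<partial>unit_meas) \<le> (\<integral>x. q powr q * (exp (1 * y x) + exp (-1 * y x)) \<partial>unit_meas)"
  proof (rule integral_mono')
    show "integrable unit_meas (\<lambda>x. q powr q * (exp (1 * y x) + exp (-1 * y x)))"
      by (intro integrable_mult_right Bochner_Integration.integrable_add int) auto
  qed (use powr_le_exp[OF q] in auto)
  also have "\<dots> = q powr q * ((\<integral>x. exp (1 * y x) \<partial>unit_meas) + (\<integral>x. exp (-1 * y x) \<partial>unit_meas))"
    using int[of 1] int[of "-1"] by simp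
  also have "\<dots> \<le> q powr q * (exp 1 + exp 1)"
    unfolding 1 2 using prod by (intro mult_left_mono add_mono) auto
  finally have le: "(\<integral>x. \<bar>y x\<bar> powr q \<partial>unit_meas) \<le> 2 * q powr q * exp 1" by simp
  have "(\<Sum>n<N. t n * rademacher n x) = s * y x" for x
    using s by (simp add: y_def sum_distrib_left)
  then have "(\<integral>x. \<bar>\<Sum>n<N. t n * rademacher n x\<bar> powr q \<partial>unit_meas) = s powr q * (\<integral>x. \<bar>y x\<bar> powr q \<partial>unit_meas)"
    using s by (simp add: abs_mult powr_mult)
  also have "\<dots> \<le> s powr q * (2 * q powr q * exp 1)" by (intro mult_left_mono le) auto
  also have "s powr q = (\<Sum>n<N. (t n)\<^sup>2) powr (q / 2)"
    using s by (simp add: s_def powr_half_sqrt[symmetric] powr_powr sum_nonneg)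
  finally show ?thesis by (simp add: mult_ac)
qed

subsection \<open>The two systems of functions\<close>

text \<open>For \<open>a > 0\<close> these are consecutive intervals descending to 0, hence
  disjoint. At \<open>a = 0\<close> the intervals would be empty, and the Rademacher functions
  supply functions of constant size instead.\<close>

definition esys :: "real \<Rightarrow> nat \<Rightarrow> real \<Rightarrow> real" where
  "esys a n = (if a = 0 then rademacher n
     else indicat_real {2 powr (- (a * (real n + 1)))<..<2 powr (- (a * real n))})"

text \<open>The constant in front of \<open>2 powr (- (a * real n))\<close> in the integral of
  \<open>\<bar>esys a n x\<bar>\<close>; with it both kinds of system obey the same
  formulas.\<close>

definition mass :: "real \<Rightarrow> real" where
  "mass a = (if a = 0 then 1 else 1 - 2 powr (- a))"

text \<open>The normalised functions \<open>esys a n\<close> satisfy the upper estimate of the unit vectors of \<open>\<ell>\<^sub>u\<close> in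
  \<open>L\<^sub>q\<close>, where \<open>u = seq_exponent a q\<close>.\<close>

definition seq_exponent :: "real \<Rightarrow> real \<Rightarrow> real" where
  "seq_exponent a q = (if a = 0 then 2 else q)"

lemma borel_measurable_esys [measurable]: "esys a n \<in> borel_measurable borel"
  by (simp add: esys_def)

lemma esys_meas [simp]: "esys a n \<in> borel_measurable unit_meas"
  by (intro borel_measurable_unit_meas) simp

lemma esys_sum_meas [simp]: "(\<lambda>x. \<Sum>n\<in>I. c n * esys a n x) \<in> borel_measurable unit_meas"
  by (intro borel_measurable_sum borel_measurable_times) simp_all

lemma abs_esys_cases: "\<bar>esys a n x\<bar> = 0 \<or> \<bar>esys a n x\<bar> = 1"
  by (simp add: esys_def indicator_def)

lemma abs_esys_le_1: "\<bar>esys a n x\<bar> \<le> 1"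
  using abs_esys_cases[of a n x] by auto

lemma abs_esys_powr: "0 < q \<Longrightarrow> \<bar>esys a n x\<bar> powr q = \<bar>esys a n x\<bar>"
  using abs_esys_cases[of a n x] by auto

lemma esys_mult_self: "esys a n x * esys a n x = \<bar>esys a n x\<bar>"
  using abs_esys_cases[of a n x] by (metis abs_mult_self_eq mult_cancel_left1 mult_zero_left)

lemma mass_pos: "0 \<le> a \<Longrightarrow> 0 < mass a"
  using powr_less_mono[of "- a" 0 2] by (auto simp: mass_def)

lemma integrable_abs_esys: "integrable unit_meas (\<lambda>x. \<bar>esys a n x\<bar>)"
  by (rule unit_meas.integrable_const_bound[where B = 1])
    (auto simp: abs_esys_le_1 intro!: borel_measurable_unit_meas)

lemma integral_abs_esys:
  assumes a: "0 \<le> a"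
  shows "(\<integral>x. \<bar>esys a n x\<bar> \<partial>unit_meas) = mass a * 2 powr (- (a * real n))"
proof (cases "a = 0")
  case True
  then show ?thesis by (simp add: esys_def mass_def space_unit_meas)
next
  case False
  let ?l = "2 powr (- (a * (real n + 1)))" and ?u = "2 powr (- (a * real n))"
  have lu: "0 < ?l" "?l \<le> ?u" "?u \<le> 1"
    using a powr_mono[of "- (a * real n)" 0 2] by (auto simp: algebra_simps)
  have "(\<integral>x. \<bar>esys a n x\<bar> \<partial>unit_meas) = (\<integral>x. indicator {0<..<1} x * indicat_real {?l<..<?u} x \<partial>lborel)"
    using False by (subst integral_unit_meas) (simp_all add: esys_def)
  also have "\<dots> = (\<integral>x. indicat_real {?l<..<?u} x \<partial>lborel)"
    using lu by (intro Bochner_Integration.integral_cong) (auto simp: indicator_def dest: less_trans[OF lu(1)])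
  also have "\<dots> = ?u - ?l" using lu by simp
  also have "\<dots> = mass a * ?u" using False by (simp add: mass_def algebra_simps powr_add[symmetric])
  finally show ?thesis .
qed

lemma esys_disjoint:
  assumes "0 < a" "m \<noteq> n"
  shows "esys a m x * esys a n x = 0"
proof -
  have "esys a m x * esys a n x = 0" if "m < n" for m n
  proof -
    have "a * (real m + 1) \<le> a * real n" using that assms(1) by (intro mult_left_mono) auto
    then have "2 powr (- (a * real n)) \<le> (2::real) powr (- (a * (real m + 1)))"
      by (intro powr_mono) auto
    then have "\<not> (2 powr (- (a * (real m + 1))) < x \<and> x < 2 powr (- (a * real n)))" by linarith
    then show ?thesis using assms(1) by (auto simp: esys_def indicator_def)
  qed
  from this[of m n] this[of n m] show ?thesis using assms(2) by (cases m n rule: linorder_cases) (auto simp: mult.commute)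
qed

lemma integral_esys_mult:
  assumes a: "0 \<le> a"
  shows "(\<integral>x. esys a m x * esys a n x \<partial>unit_meas) = (if m = n then mass a * 2 powr (- (a * real n)) else 0)"
proof (cases "m = n")
  case True
  then show ?thesis by (simp add: esys_mult_self integral_abs_esys a)
next
  case False
  show ?thesis
  proof (cases "a = 0")
    case True
    then show ?thesis
      using False integral_rademacher_orthogonal[of m n] integral_rademacher_orthogonal[of n m]
      by (cases m n rule: linorder_cases) (auto simp: esys_def mult.commute)
  next
    case a0: False
    then show ?thesis using a False by (simp add: esys_disjoint)
  qed
qed

abbreviation Esys :: "real \<Rightarrow> nat \<Rightarrow> L0" where
  "Esys a n \<equiv> abs_L0 (esys a n)"

lemma Esys_Linf: "Esys a n \<in> carr Linf"
  by (auto simp: Linf_def ess_bound.abs_eq intro!: exI[of _ 1] abs_esys_le_1)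

lemma in_Lp_Esys: "0 < q \<Longrightarrow> in_Lp q (Esys a n)"
  by (simp add: in_Lp.abs_eq abs_esys_powr integrable_abs_esys)

lemma Lp_norm_Esys: "0 < q \<Longrightarrow> 0 \<le> a \<Longrightarrow> Lp_norm q (Esys a n) = (mass a * 2 powr (- (a * real n))) powr (1 / q)"
  by (simp add: Lp_norm.abs_eq abs_esys_powr integral_abs_esys)

lemma Lp_norm_scaled_Esys:
  assumes "0 < q" "0 \<le> a"
  shows "Lp_norm q ((2 powr (a * real n / q)) *\<^sub>R Esys a n) = mass a powr (1 / q)"
  using assms mass_pos[of a] by (simp add: Lp_norm_scaleR Lp_norm_Esys powr_mult powr_powr powr_add[symmetric])

lemma sum_scaleR_Esys:
  "(\<Sum>n\<in>I. c n *\<^sub>R Esys a n) = abs_L0 (\<lambda>x. \<Sum>n\<in>I. c n * esys a n x)"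
proof -
  have "(\<Sum>n\<in>I. c n *\<^sub>R Esys a n) = (\<Sum>n\<in>I. abs_L0 (\<lambda>x. c n * esys a n x))"
    by (intro sum.cong) (simp_all add: scaleR_L0.abs_eq)
  also have "\<dots> = abs_L0 (\<lambda>x. \<Sum>n\<in>I. c n * esys a n x)" by (intro sum_abs_L0 borel_measurable_times) simp_all
  finally show ?thesis .
qed

text \<open>At each point at most one of the disjoint indicators is nonzero.\<close>

lemma sum_disjoint_powr:
  fixes t :: "nat \<Rightarrow> real"
  assumes "0 < a" "0 < q" "finite I"
  shows "\<bar>\<Sum>n\<in>I. t n * esys a n x\<bar> powr q = (\<Sum>n\<in>I. \<bar>t n\<bar> powr q * \<bar>esys a n x\<bar>)"
proof (cases "\<exists>k\<in>I. esys a k x \<noteq> 0")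
  case True
  then obtain k where k: "k \<in> I" "esys a k x \<noteq> 0" by blast
  have 0: "esys a n x = 0" if "n \<noteq> k" for n
    using esys_disjoint[OF assms(1) that, of x] k by simp
  have "(\<Sum>n\<in>I. t n * esys a n x) = t k * esys a k x"
    using k 0 by (subst sum.remove[OF assms(3) k(1)]) (auto intro!: sum.neutral)
  moreover have "(\<Sum>n\<in>I. \<bar>t n\<bar> powr q * \<bar>esys a n x\<bar>) = \<bar>t k\<bar> powr q * \<bar>esys a k x\<bar>"
    using k 0 by (subst sum.remove[OF assms(3) k(1)]) (auto intro!: sum.neutral)
  ultimately show ?thesis using assms by (simp add: abs_mult powr_mult abs_esys_powr)
next
  case False
  then show ?thesis by simp
qed

text \<open>For \<open>a = 0\<close> this is Khintchine's inequality after taking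
  \<open>q\<close>-th roots. For \<open>a > 0\<close> disjointness makes it an equality,
  \<open>C\<close> being the common norm of the scaled functions.\<close>

lemma Lp_norm_Esys_sum_le_aux:
  assumes a: "0 \<le> a" and q: "1 < q"
  obtains C where "0 < C" "\<And>N t. Lp_norm q (\<Sum>n<N. t n *\<^sub>R (2 powr (a * real n / q)) *\<^sub>R Esys a n)
    \<le> C * (\<Sum>n<N. \<bar>t n\<bar> powr seq_exponent a q) powr (1 / seq_exponent a q)"
proof (cases "a = 0")
  case True
  have esys_0: "rademacher n = esys 0 n" for n by (simp add: esys_def)
  define C where "C = (2 * q powr q * exp 1) powr (1 / q)"
  show thesis
  proof
    show "0 < C" using q by (simp add: C_def)
    fix N and t :: "nat \<Rightarrow> real"
    have "(\<integral>x. \<bar>\<Sum>n<N. t n * rademacher n x\<bar> powr q \<partial>unit_meas) powr (1 / q) \<le>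
        (2 * q powr q * exp 1 * (\<Sum>n<N. (t n)\<^sup>2) powr (q / 2)) powr (1 / q)"
      using q by (intro powr_mono2 integral_rademacher_sum_powr_le) (auto intro!: integral_nonneg_AE)
    also have "\<dots> = C * (\<Sum>n<N. (t n)\<^sup>2) powr (1 / 2)"
      using q by (simp add: C_def powr_mult powr_powr)
    finally show "Lp_norm q (\<Sum>n<N. t n *\<^sub>R (2 powr (a * real n / q)) *\<^sub>R Esys a n)
        \<le> C * (\<Sum>n<N. \<bar>t n\<bar> powr seq_exponent a q) powr (1 / seq_exponent a q)"
      using True by (simp add: sum_scaleR_Esys Lp_norm.abs_eq seq_exponent_def esys_0)
  qed
next
  case False
  define C where "C = mass a powr (1 / q)"
  show thesis
  proof
    show "0 < C" using mass_pos[OF a] by (simp add: C_def)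
    fix N and t :: "nat \<Rightarrow> real"
    have "(\<integral>x. \<bar>\<Sum>n<N. (t n * 2 powr (a * real n / q)) * esys a n x\<bar> powr q \<partial>unit_meas)
       = (\<Sum>n<N. \<bar>t n * 2 powr (a * real n / q)\<bar> powr q * (\<integral>x. \<bar>esys a n x\<bar> \<partial>unit_meas))"
      using False a q by (simp add: sum_disjoint_powr integrable_abs_esys)
    also have "\<dots> = mass a * (\<Sum>n<N. \<bar>t n\<bar> powr q)"
      using q a by (simp add: integral_abs_esys abs_mult powr_mult powr_powr sum_distrib_left
        powr_minus field_simps)
    finally show "Lp_norm q (\<Sum>n<N. t n *\<^sub>R (2 powr (a * real n / q)) *\<^sub>R Esys a n)
        \<le> C * (\<Sum>n<N. \<bar>t n\<bar> powr seq_exponent a q) powr (1 / seq_exponent a q)"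
      using False mass_pos[OF a]
      by (simp add: sum_scaleR_Esys Lp_norm.abs_eq seq_exponent_def C_def powr_mult sum_nonneg)
  qed
qed

text \<open>Padding with zero coefficients reduces finite index sets to initial segments. The
  general form serves for blocks of a series.\<close>

lemma Lp_norm_Esys_sum_le:
  assumes a: "0 \<le> a" and q: "1 < q"
  obtains C where "0 < C" "\<And>I t. finite I \<Longrightarrow>
    Lp_norm q (\<Sum>n\<in>I. t n *\<^sub>R (2 powr (a * real n / q)) *\<^sub>R Esys a n)
    \<le> C * (\<Sum>n\<in>I. \<bar>t n\<bar> powr seq_exponent a q) powr (1 / seq_exponent a q)"
proof -
  obtain C where C: "0 < C" "\<And>N t. Lp_norm q (\<Sum>n<N. t n *\<^sub>R (2 powr (a * real n / q)) *\<^sub>R Esys a n)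
    \<le> C * (\<Sum>n<N. \<bar>t n\<bar> powr seq_exponent a q) powr (1 / seq_exponent a q)"
    using Lp_norm_Esys_sum_le_aux[OF a q] by blast
  have "Lp_norm q (\<Sum>n\<in>I. t n *\<^sub>R (2 powr (a * real n / q)) *\<^sub>R Esys a n)
    \<le> C * (\<Sum>n\<in>I. \<bar>t n\<bar> powr seq_exponent a q) powr (1 / seq_exponent a q)" if I: "finite I" for I t
  proof -
    obtain N where N: "I \<subseteq> {..<N}" using I finite_nat_iff_bounded by blast
    let ?t = "\<lambda>n. if n \<in> I then t n else 0"
    have "(\<Sum>n\<in>I. t n *\<^sub>R (2 powr (a * real n / q)) *\<^sub>R Esys a n) =
        (\<Sum>n<N. ?t n *\<^sub>R (2 powr (a * real n / q)) *\<^sub>R Esys a n)"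
      using N by (intro sum.mono_neutral_cong_left) auto
    moreover have "(\<Sum>n\<in>I. \<bar>t n\<bar> powr seq_exponent a q) = (\<Sum>n<N. \<bar>?t n\<bar> powr seq_exponent a q)"
      using N by (intro sum.mono_neutral_cong_left) auto
    ultimately show ?thesis using C(2)[where N = N and t = ?t] by simp
  qed
  then show thesis using C(1) that by blast
qed

section \<open>Duality for the two systems\<close>

lemma conjugate_exponent:
  fixes p :: real
  assumes "1 < p"
  shows "1 < p / (p - 1)" "1 / p + 1 / (p / (p - 1)) = 1"
  using assms by (auto simp: field_simps)

lemma integrable_pairing:
  assumes "1 < p" "1 < p'" "1 / p + 1 / p' = 1" "in_Lp p f" "in_Lp p' g"
    "f = abs_L0 f'" "f' \<in> borel_measurable unit_meas" "g = abs_L0 g'" "g' \<in> borel_measurable unit_meas"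
  shows "integrable unit_meas (\<lambda>x. f' x * g' x)"
  using Holder(1)[OF assms(1-3), of f' g'] assms(4-) by (simp add: in_Lp.abs_eq)

lemma abs_pairing_le:
  assumes "1 < p" "1 < p'" "1 / p + 1 / p' = 1" "in_Lp p f" "in_Lp p' g"
  shows "\<bar>pairing f g\<bar> \<le> Lp_norm p f * Lp_norm p' g"
proof -
  obtain f' where f': "f' \<in> borel_measurable unit_meas" "f = abs_L0 f'" by (rule L0_cases)
  obtain g' where g': "g' \<in> borel_measurable unit_meas" "g = abs_L0 g'" by (rule L0_cases)
  show ?thesis
    using Holder(2)[OF assms(1-3), of f' g'] f' g' assms(4-)
    by (simp add: in_Lp.abs_eq pairing.abs_eq)
qed

lemma pairing_scaleR: "pairing (c *\<^sub>R f) g = c * pairing f g" "pairing f (c *\<^sub>R g) = c * pairing f g"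
  by (transfer; simp add: mult_ac)+

lemma pairing_commute: "pairing f g = pairing g f"
  by transfer (simp add: mult.commute)

lemma pairing_zero: "pairing f 0 = 0"
  by transfer simp

lemma pairing_add_right:
  assumes p: "1 < p" "1 < p'" "1 / p + 1 / p' = 1" and "in_Lp p f" "in_Lp p' g" "in_Lp p' h"
  shows "pairing f (g + h) = pairing f g + pairing f h"
proof -
  obtain f' where f': "f' \<in> borel_measurable unit_meas" "f = abs_L0 f'" by (rule L0_cases)
  obtain g' where g': "g' \<in> borel_measurable unit_meas" "g = abs_L0 g'" by (rule L0_cases)
  obtain h' where h': "h' \<in> borel_measurable unit_meas" "h = abs_L0 h'" by (rule L0_cases)
  have "integrable unit_meas (\<lambda>x. f' x * g' x)" "integrable unit_meas (\<lambda>x. f' x * h' x)"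
    by (rule integrable_pairing[OF p assms(4,5)] integrable_pairing[OF p assms(4,6)]; fact f' g' h')+
  then show ?thesis using f' g' h' by (simp add: plus_L0.abs_eq pairing.abs_eq distrib_left)
qed

lemma pairing_add_left:
  assumes "1 < p" "1 < p'" "1 / p + 1 / p' = 1" "in_Lp p f" "in_Lp p g" "in_Lp p' h"
  shows "pairing (f + g) h = pairing f h + pairing g h"
  using pairing_add_right[of p' p h f g] assms by (simp add: pairing_commute add.commute)

lemma pairing_sum:
  assumes p: "1 < p" "1 < p'" "1 / p + 1 / p' = 1" and f: "in_Lp p f" and g: "\<And>i. i \<in> I \<Longrightarrow> in_Lp p' (g i)"
  shows "pairing f (\<Sum>i\<in>I. g i) = (\<Sum>i\<in>I. pairing f (g i))"
proof -
  interpret normed_subspace "Lp p'" using p by (intro normed_subspace_Lp) simp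
  show ?thesis
    using g
  proof (induction I rule: infinite_finite_induct)
    case (insert i I)
    then show ?case using carr_sum[of I g] by (simp add: pairing_add_right[OF p f])
  qed (simp_all add: pairing_zero)
qed

lemma pairing_Esys:
  "0 \<le> a \<Longrightarrow> pairing (Esys a m) (Esys a n) = (if m = n then mass a * 2 powr (- (a * real n)) else 0)"
  by (simp add: pairing.abs_eq integral_esys_mult)

text \<open>By orthogonality, pairing the difference with the \<open>m\<close>-th function,
  normalised for the conjugate exponent, gives \<open>mass a\<close>; Hoelder's inequality turns
  this into a lower bound for the norm.\<close>

lemma Esys_separated:
  assumes a: "0 \<le> a" and q: "1 < q"
  obtains \<delta> where "0 < \<delta>" "\<And>m n. m \<noteq> n \<Longrightarrow>
    \<delta> \<le> Lp_norm q ((2 powr (a * real m / q)) *\<^sub>R Esys a m - (2 powr (a * real n / q)) *\<^sub>R Esys a n)"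
proof
  interpret normed_subspace "Lp q" using q by (intro normed_subspace_Lp) simp
  note q' = conjugate_exponent[OF q]
  let ?q' = "q / (q - 1)"
  show "0 < mass a / mass a powr (1 / ?q')" using mass_pos[OF a] by simp
  fix m n :: nat assume mn: "m \<noteq> n"
  let ?f = "\<lambda>q n. (2 powr (a * real n / q)) *\<^sub>R Esys a n"
  have in_q: "in_Lp q (?f q n)" "in_Lp ?q' (?f ?q' n)" for n
    using q q' by (auto intro!: in_Lp_scaleR in_Lp_Esys)
  have "?f q m - ?f q n = ?f q m + (-1) *\<^sub>R ?f q n" by simp
  also have "pairing \<dots> (?f ?q' m) = pairing (?f q m) (?f ?q' m) + pairing ((-1) *\<^sub>R ?f q n) (?f ?q' m)"
    by (intro pairing_add_left[OF q q'] in_q in_Lp_scaleR)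
  also have "\<dots> = mass a"
  proof -
    have "2 powr (a * real m / q) * 2 powr (a * real m / ?q') = (2::real) powr (a * real m * (1 / q + 1 / ?q'))"
      by (simp add: powr_add[symmetric] distrib_left)
    then have "2 powr (a * real m / q) * 2 powr (a * real m / ?q') = (2::real) powr (a * real m)"
      unfolding q'(2) by simp
    then have "2 powr (a * real m / q) * (2 powr (a * real m / ?q') * 2 powr (- (a * real m))) = (1::real)"
      by (simp add: powr_minus flip: mult.assoc)
    from arg_cong[OF this, of "(*) (mass a)"] show ?thesis
      unfolding pairing_scaleR pairing_Esys[OF a] using mn by (simp add: mult_ac)
  qed
  finally have "mass a \<le> \<bar>pairing (?f q m - ?f q n) (?f ?q' m)\<bar>" by simp
  also have "\<dots> \<le> Lp_norm q (?f q m - ?f q n) * Lp_norm ?q' (?f ?q' m)"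
    using carr_diff[of "?f q m" "?f q n"] in_q by (intro abs_pairing_le[OF q q']) auto
  also have "Lp_norm ?q' (?f ?q' m) = mass a powr (1 / ?q')"
    using q'(1) by (intro Lp_norm_scaled_Esys a) simp
  finally show "mass a / mass a powr (1 / ?q') \<le> Lp_norm q (?f q m - ?f q n)"
    using mass_pos[OF a] by (simp add: divide_le_eq)
qed

text \<open>This is \<open>Lp_norm_Esys_sum_le\<close> for the conjugate exponent, dualised.\<close>

lemma Esys_coefficients_le:
  assumes a: "0 \<le> a" and p: "1 < p"
  obtains C where "0 < C" "\<And>N f. in_Lp p f \<Longrightarrow>
    (\<Sum>n<N. \<bar>2 powr (a * real n * (1 - 1 / p)) * pairing f (Esys a n)\<bar> powr seq_exponent a p)
      \<le> (C * Lp_norm p f) powr seq_exponent a p"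
proof -
  note p' = conjugate_exponent[OF p]
  let ?p' = "p / (p - 1)"
  define u where "u = seq_exponent a p"
  define u' where "u' = seq_exponent a ?p'"
  \<comment> \<open>The sequence exponents belonging to \<open>p\<close> and to its conjugate are
    again conjugate: both are 2 when \<open>a = 0\<close>.\<close>
  have u: "1 < u" "1 < u'" "1 / u + 1 / u' = 1" "(u - 1) * u' = u"
    using p p' by (auto simp: u_def u'_def seq_exponent_def)
  obtain C where C: "0 < C" "\<And>I t. finite I \<Longrightarrow>
    Lp_norm ?p' (\<Sum>n\<in>I. t n *\<^sub>R (2 powr (a * real n / ?p')) *\<^sub>R Esys a n)
    \<le> C * (\<Sum>n\<in>I. \<bar>t n\<bar> powr u') powr (1 / u')"
    using Lp_norm_Esys_sum_le[OF a p'(1)] unfolding u'_def by blast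
  have "(\<Sum>n<N. \<bar>2 powr (a * real n * (1 - 1 / p)) * pairing f (Esys a n)\<bar> powr u) \<le> (C * Lp_norm p f) powr u"
    if f: "in_Lp p f" for N f
  proof -
    have "1 - 1 / p = 1 / ?p'" using p'(2) by simp
    then have e: "a * real n * (1 - 1 / p) = a * real n / ?p'" for n by (metis times_divide_eq_right mult.right_neutral)
    define y where "y n = 2 powr (a * real n / ?p') * pairing f (Esys a n)" for n
    define A where "A = (\<Sum>n<N. \<bar>y n\<bar> powr u)"
    \<comment> \<open>The sequence giving equality in Hoelder's inequality for sums: both
      \<open>t n * y n\<close> and \<open>\<bar>t n\<bar> powr u'\<close> equal
      \<open>\<bar>y n\<bar> powr u\<close>.\<close>
    define t where "t n = sgn (y n) * \<bar>y n\<bar> powr (u - 1)" for n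
    define g where "g = (\<Sum>n<N. t n *\<^sub>R (2 powr (a * real n / ?p')) *\<^sub>R Esys a n)"
    interpret normed_subspace "Lp ?p'" using p'(1) by (intro normed_subspace_Lp) simp
    have g: "in_Lp ?p' g"
      using carr_sum[of "{..<N}" "\<lambda>n. t n *\<^sub>R (2 powr (a * real n / ?p')) *\<^sub>R Esys a n"] p'(1)
      by (simp add: g_def in_Lp_scaleR in_Lp_Esys)
    have "\<bar>y n\<bar> * \<bar>y n\<bar> powr (u - 1) = \<bar>y n\<bar> powr u" for n
      by (simp add: powr_mult_base)
    then have ty: "t n * y n = \<bar>y n\<bar> powr u" for n
      by (simp add: t_def abs_sgn mult_ac)
    have tu: "\<bar>t n\<bar> powr u' = \<bar>y n\<bar> powr u" for n
      using u by (cases "y n = 0") (simp_all add: t_def abs_mult powr_powr)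
    have "A = (\<Sum>n<N. t n * y n)" by (simp add: A_def ty)
    also have "\<dots> = (\<Sum>n<N. pairing f (t n *\<^sub>R (2 powr (a * real n / ?p')) *\<^sub>R Esys a n))"
      by (simp add: pairing_scaleR y_def mult_ac)
    also have "\<dots> = pairing f g"
      unfolding g_def using p' by (intro pairing_sum[OF p p', symmetric] f in_Lp_scaleR in_Lp_Esys) auto
    also have "\<dots> \<le> Lp_norm p f * Lp_norm ?p' g"
      using abs_pairing_le[OF p p' f g] by linarith
    also have "\<dots> \<le> Lp_norm p f * (C * A powr (1 / u'))"
      using C(2)[of "{..<N}" t] unfolding g_def A_def tu by (intro mult_left_mono) auto
    finally have le: "A \<le> C * Lp_norm p f * A powr (1 / u')" by (simp add: mult_ac)
    have A0: "0 \<le> A" unfolding A_def by (intro sum_nonneg) auto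
    have "A \<le> (C * Lp_norm p f) powr u"
    proof (cases "A = 0")
      case False
      then have A: "0 < A" using A0 by simp
      have "1 / u = 1 - 1 / u'" using u(3) by linarith
      then have "A powr (1 / u) = A powr (1 - 1 / u')" by (simp only:)
      also have "\<dots> \<le> C * Lp_norm p f" using le A by (simp add: powr_diff divide_le_eq)
      finally have "(A powr (1 / u)) powr u \<le> (C * Lp_norm p f) powr u"
        using u by (intro powr_mono2) auto
      then show ?thesis using u A by (simp add: powr_powr)
    qed simp
    then show ?thesis by (simp add: A_def y_def e)
  qed
  then show thesis using C(1) that unfolding u_def by blast
qed

subsection \<open>The diagonal operators\<close>

text \<open>Each \<open>\<bar>y n\<bar>\<close> is at most \<open>K\<close>, so the excess power
  \<open>v - u\<close> is estimated by \<open>K\<close> and the rest is summed.\<close>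

lemma sum_powr_le_of_exponent_le:
  fixes y :: "nat \<Rightarrow> real"
  assumes "0 < u" "u \<le> v" "0 \<le> K" "(\<Sum>n<N. \<bar>y n\<bar> powr u) \<le> K powr u"
  shows "(\<Sum>n<N. \<bar>y n\<bar> powr v) \<le> K powr v"
proof -
  have le: "\<bar>y n\<bar> \<le> K" if "n < N" for n
  proof -
    have "\<bar>y n\<bar> powr u \<le> (\<Sum>n<N. \<bar>y n\<bar> powr u)" using that by (intro member_le_sum) auto
    then have "\<bar>y n\<bar> powr u \<le> K powr u" using assms(4) by linarith
    then show ?thesis using assms(1,3) powr_less_mono2[of u K "\<bar>y n\<bar>"] by force
  qed
  have split: "x powr v = x powr (v - u) * x powr u" for x :: real
    by (simp add: powr_add[symmetric])
  have "(\<Sum>n<N. \<bar>y n\<bar> powr v) \<le> (\<Sum>n<N. K powr (v - u) * \<bar>y n\<bar> powr u)"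
    using le assms by (intro sum_mono) (auto simp: split intro!: mult_right_mono powr_mono2)
  also have "\<dots> = K powr (v - u) * (\<Sum>n<N. \<bar>y n\<bar> powr u)" by (simp add: sum_distrib_left)
  also have "\<dots> \<le> K powr (v - u) * K powr u" by (intro mult_left_mono assms) auto
  finally show ?thesis by (simp add: split[symmetric])
qed

locale diagonal_operator =
  fixes a b d :: real
  assumes a: "0 \<le> a" and b: "0 \<le> b"
begin

definition coef :: "nat \<Rightarrow> L0 \<Rightarrow> real" where
  "coef n f = 2 powr ((a + d) * real n) * pairing f (Esys a n)"

definition psum :: "nat \<Rightarrow> L0 \<Rightarrow> L0" where
  "psum N f = (\<Sum>n<N. coef n f *\<^sub>R Esys b n)"

text \<open>Convergence in any \<open>L\<^sub>q\<close> implies convergence in \<open>L\<^sub>1\<close>, so that this one definition yields the extension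
  to \<open>L\<^sub>p \<rightarrow> L\<^sub>q\<close> for every pair \<open>(p, q)\<close> for which there is one; elsewhere the value is junk.\<close>

definition T :: "L0 \<Rightarrow> L0" where
  "T f = (THE g. in_Lp 1 g \<and> (\<lambda>N. Lp_norm 1 (g - psum N f)) \<longlonglongrightarrow> 0)"

lemma psum_in_Lp: "1 \<le> q \<Longrightarrow> in_Lp q (psum N f)"
  using normed_subspace.carr_sum[OF normed_subspace_Lp, of q "{..<N}" "\<lambda>n. coef n f *\<^sub>R Esys b n"]
  by (simp add: psum_def in_Lp_scaleR in_Lp_Esys)

lemma T_eqI:
  assumes q: "1 < q" and g: "in_Lp q g" "(\<lambda>N. Lp_norm q (g - psum N f)) \<longlonglongrightarrow> 0"
  shows "T f = g"
  unfolding T_def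
proof (rule the_equality)
  interpret L1: normed_subspace "Lp 1" by (rule normed_subspace_Lp) simp
  interpret Lq: normed_subspace "Lp q" using q by (intro normed_subspace_Lp) simp
  have "Lp_norm 1 (g - psum N f) \<le> Lp_norm q (g - psum N f)" for N
    using Lp_subset(2)[OF q] Lq.carr_diff[of g "psum N f"] g psum_in_Lp[of q] q by simp
  then have "(\<lambda>N. Lp_norm 1 (g - psum N f)) \<longlonglongrightarrow> 0"
    by (intro Lim_null_comparison[OF _ g(2)]) simp
  then show *: "in_Lp 1 g \<and> (\<lambda>N. Lp_norm 1 (g - psum N f)) \<longlonglongrightarrow> 0"
    using Lp_subset(1)[OF q g(1)] by simp
  show "g' = g" if "in_Lp 1 g' \<and> (\<lambda>N. Lp_norm 1 (g' - psum N f)) \<longlonglongrightarrow> 0" for g'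
    using L1.limit_unique[of g' g "\<lambda>N. psum N f"] that * psum_in_Lp[of 1] by simp
qed

lemma coef_Esys: "coef m (Esys a n) = (if m = n then mass a * 2 powr (d * real n) else 0)"
proof -
  have "2 powr ((a + d) * real n) * 2 powr (- (a * real n)) = (2::real) powr (d * real n)"
    by (simp add: powr_add[symmetric] algebra_simps)
  then show ?thesis by (auto simp: coef_def pairing_Esys a)
qed

text \<open>By orthogonality a single term of the series survives, so the partial sums are
  eventually constant and converge in every space; the exponent 2 is an arbitrary choice.\<close>

lemma T_Esys: "T (Esys a n) = (mass a * 2 powr (d * real n)) *\<^sub>R Esys b n"
proof (rule T_eqI[where q = 2])
  have "psum N (Esys a n) = (mass a * 2 powr (d * real n)) *\<^sub>R Esys b n" if "n < N" for N
  proof -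
    have "psum N (Esys a n) = (\<Sum>m<N. if m = n then (mass a * 2 powr (d * real n)) *\<^sub>R Esys b m else 0)"
      unfolding psum_def by (intro sum.cong) (auto simp: coef_Esys)
    then show ?thesis using that by simp
  qed
  then have "\<forall>\<^sub>F N in sequentially. Lp_norm 2 ((mass a * 2 powr (d * real n)) *\<^sub>R Esys b n - psum N (Esys a n)) = 0"
    by (intro eventually_sequentiallyI[of "Suc n"]) simp
  then show "(\<lambda>N. Lp_norm 2 ((mass a * 2 powr (d * real n)) *\<^sub>R Esys b n - psum N (Esys a n))) \<longlonglongrightarrow> 0"
    by (rule tendsto_eventually)
qed (auto intro!: in_Lp_scaleR in_Lp_Esys)

end

section \<open>The operator between a fixed pair of spaces\<close>

locale diagonal_operator_at = diagonal_operator +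
  fixes p q :: real
  assumes p: "1 < p" and q: "1 < q"
begin

text \<open>The coefficients of \<open>f\<close> against the system normalised for the conjugate of
  \<open>p\<close>, as \<open>1 - 1 / p\<close> is the reciprocal of that exponent.\<close>

definition y :: "nat \<Rightarrow> L0 \<Rightarrow> real" where
  "y n f = 2 powr (a * real n * (1 - 1 / p)) * pairing f (Esys a n)"

definition g :: "nat \<Rightarrow> L0" where
  "g n = (2 powr (a * real n / p)) *\<^sub>R Esys a n"

definition h :: "nat \<Rightarrow> L0" where
  "h n = (2 powr (b * real n / q)) *\<^sub>R Esys b n"

text \<open>\<open>\<rho> ^ n\<close> is the factor by which the operator multiplies the
  \<open>n\<close>-th normalised coefficient, so \<open>\<rho>\<close> is below, equal to or above 1
  according to whether \<open>(1 / p, 1 / q)\<close> lies to the left of the line, on it or to its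
  right.\<close>

definition \<rho> :: real where
  "\<rho> = 2 powr (d - (b / q - a / p))"

lemma \<rho>_pos: "0 < \<rho>"
  by (simp add: \<rho>_def)

lemma \<rho>_power: "\<rho> ^ n = 2 powr ((d - (b / q - a / p)) * real n)"
  by (simp add: \<rho>_def powr_realpow[symmetric] powr_powr)

lemma h_in_Lp: "in_Lp q (h n)"
  using q by (simp add: h_def in_Lp_scaleR in_Lp_Esys)

lemma g_in_Lp: "in_Lp p (g n)"
  using p by (simp add: g_def in_Lp_scaleR in_Lp_Esys)

lemma norm_g: "Lp_norm p (g n) = mass a powr (1 / p)"
  using p a unfolding g_def by (intro Lp_norm_scaled_Esys) auto

lemma norm_h: "Lp_norm q (h n) = mass b powr (1 / q)"
  using q b unfolding h_def by (intro Lp_norm_scaled_Esys) auto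

lemma coef_eq: "coef n f *\<^sub>R Esys b n = (\<rho> ^ n * y n f) *\<^sub>R h n"
proof -
  have "2 powr ((d - (b / q - a / p)) * real n) * 2 powr (a * real n * (1 - 1 / p)) * 2 powr (b * real n / q)
      = (2::real) powr ((a + d) * real n)"
    by (simp add: powr_add[symmetric] algebra_simps)
  then show ?thesis
    by (simp add: coef_def y_def h_def \<rho>_power mult_ac)
qed

lemma psum_eq: "psum N f = (\<Sum>n<N. (\<rho> ^ n * y n f) *\<^sub>R h n)"
  by (simp add: psum_def coef_eq)

lemma y_linear: "linear_on_set (carr (Lp p)) (\<lambda>f. c * y n f)"
  unfolding linear_on_set_def
  using pairing_add_left[OF p conjugate_exponent[OF p], of _ _ "Esys a n"] conjugate_exponent[OF p]
  by (simp add: y_def pairing_scaleR distrib_left in_Lp_Esys)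

sublocale X: normed_subspace "Lp p"
  using p by (intro normed_subspace_Lp) simp

sublocale Y: normed_subspace "Lp q"
  using q by (intro normed_subspace_Lp) simp

text \<open>Blocks bounded by a null sequence make the partial sums Cauchy; completeness gives a
  limit in \<open>L\<^sub>q\<close>, and \<open>T_eqI\<close> identifies it with
  \<open>T f\<close>.\<close>

lemma series_opI:
  assumes "\<And>f. in_Lp p f \<Longrightarrow> \<exists>K. K \<longlonglongrightarrow> 0 \<and>
    (\<forall>M. \<forall>N\<ge>M. Lp_norm q (\<Sum>n=M..<N. (\<rho> ^ n * y n f) *\<^sub>R h n) \<le> K M)"
  shows "series_op (Lp p) (Lp q) (\<lambda>n f. \<rho> ^ n * y n f) h T"
proof
  show "linear_on_set (carr (Lp p)) (\<lambda>f. \<rho> ^ n * y n f)" for n by (rule y_linear)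
  show "h n \<in> carr (Lp q)" for n by (simp add: h_in_Lp)
  have *: "in_Lp q (T f) \<and> (\<lambda>N. Lp_norm q (T f - psum N f)) \<longlonglongrightarrow> 0" if f: "in_Lp p f" for f
  proof -
    obtain K where K: "K \<longlonglongrightarrow> 0" "\<And>M N. M \<le> N \<Longrightarrow> Lp_norm q (\<Sum>n=M..<N. (\<rho> ^ n * y n f) *\<^sub>R h n) \<le> K M"
      using assms[OF f] by blast
    have "\<exists>x\<in>carr (Lp q). (\<lambda>N. nrm (Lp q) (x - psum N f)) \<longlonglongrightarrow> 0"
    proof (rule Y.complete_limit[OF mcomplete_Lp[OF q]])
      show "psum n f \<in> carr (Lp q)" for n using q by (simp add: psum_in_Lp)
      fix e :: real assume "0 < e"
      then obtain M where M: "\<And>m. M \<le> m \<Longrightarrow> K m < e"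
        using LIMSEQ_D[OF K(1), of e] by force
      have "nrm (Lp q) (psum n f - psum m f) < e" if "M \<le> m" "m \<le> n" for m n
      proof -
        have "psum n f - psum m f = (\<Sum>n=m..<n. (\<rho> ^ n * y n f) *\<^sub>R h n)"
          unfolding psum_eq using that by (simp add: lessThan_atLeast0 sum_diff_nat_ivl)
        then show ?thesis using K(2)[OF that(2)] M[OF that(1)] by simp
      qed
      then show "\<exists>M. \<forall>m\<ge>M. \<forall>n\<ge>m. nrm (Lp q) (psum n f - psum m f) < e" by blast
    qed
    then obtain x where x: "in_Lp q x" "(\<lambda>N. Lp_norm q (x - psum N f)) \<longlonglongrightarrow> 0" by auto
    then show ?thesis using T_eqI[OF q x] by simp
  qed
  show "T f \<in> carr (Lp q)" "(\<lambda>N. nrm (Lp q) (T f - (\<Sum>n<N. (\<rho> ^ n * y n f) *\<^sub>R h n))) \<longlonglongrightarrow> 0"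
    if "f \<in> carr (Lp p)" for f
    using *[of f] that by (simp_all add: psum_eq)
qed

lemma y_bound:
  obtains C where "0 < C" "\<And>N f. in_Lp p f \<Longrightarrow>
    (\<Sum>n<N. \<bar>y n f\<bar> powr seq_exponent a p) \<le> (C * Lp_norm p f) powr seq_exponent a p"
  using Esys_coefficients_le[OF a p] unfolding y_def by blast

lemma seq_exponent_gt_1: "1 < seq_exponent a p" "1 < seq_exponent b q"
  using p q by (auto simp: seq_exponent_def)

text \<open>Here \<open>\<rho> < 1\<close>, while the coefficients \<open>y n f\<close> are bounded
  by a fixed multiple of the norm of \<open>f\<close>, so the tails of the series decay like
  \<open>\<rho> ^ M\<close>.\<close>

lemma compact_above_line:
  assumes "d < b / q - a / p"
  shows "compact_op (Lp p) (Lp q) T" "strictly_singular_op (Lp p) (Lp q) T"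
proof -
  have r1: "\<rho> < 1" unfolding \<rho>_def using assms powr_less_mono[of "d - (b / q - a / p)" 0 2] by simp
  obtain C where C: "0 < C" "\<And>N f. in_Lp p f \<Longrightarrow>
      (\<Sum>n<N. \<bar>y n f\<bar> powr seq_exponent a p) \<le> (C * Lp_norm p f) powr seq_exponent a p"
    using y_bound by blast
  have y_le: "\<bar>y n f\<bar> \<le> C * Lp_norm p f" if f: "in_Lp p f" for n f
  proof -
    have "\<bar>y n f\<bar> powr seq_exponent a p \<le> (\<Sum>n<Suc n. \<bar>y n f\<bar> powr seq_exponent a p)"
      by (rule member_le_sum) auto
    also have "\<dots> \<le> (C * Lp_norm p f) powr seq_exponent a p" by (rule C(2)[OF f])
    finally show ?thesis
      using powr_less_mono2[of "seq_exponent a p" "C * Lp_norm p f" "\<bar>y n f\<bar>"] seq_exponent_gt_1 C(1)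
      by force
  qed
  define B where "B = mass b powr (1 / q)"
  define \<epsilon> where "\<epsilon> M = C * B / (1 - \<rho>) * \<rho> ^ M" for M
  have B: "0 \<le> B" by (simp add: B_def)
  have \<epsilon>: "\<epsilon> \<longlonglongrightarrow> 0"
    unfolding \<epsilon>_def using r1 \<rho>_pos by (intro tendsto_mult_right_zero LIMSEQ_realpow_zero) auto
  have tail: "Lp_norm q (\<Sum>n=M..<N. (\<rho> ^ n * y n f) *\<^sub>R h n) \<le> \<epsilon> M * Lp_norm p f"
    if f: "in_Lp p f" and MN: "M \<le> N" for M N f
  proof -
    have "Lp_norm q (\<Sum>n=M..<N. (\<rho> ^ n * y n f) *\<^sub>R h n) \<le> (\<Sum>n=M..<N. Lp_norm q ((\<rho> ^ n * y n f) *\<^sub>R h n))"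
      using Y.nrm_sum[of "{M..<N}" "\<lambda>n. (\<rho> ^ n * y n f) *\<^sub>R h n"] by (simp add: in_Lp_scaleR h_in_Lp)
    also have "\<dots> = (\<Sum>n=M..<N. \<rho> ^ n * \<bar>y n f\<bar> * B)"
      using \<rho>_pos q by (intro sum.cong) (simp_all add: Lp_norm_scaleR norm_h B_def abs_mult)
    also have "\<dots> \<le> (\<Sum>n=M..<N. \<rho> ^ n * (C * Lp_norm p f) * B)"
      using \<rho>_pos y_le[OF f] B by (intro sum_mono mult_right_mono mult_left_mono) auto
    also have "\<dots> = (\<Sum>n=M..<N. \<rho> ^ n) * (C * Lp_norm p f * B)"
      unfolding sum_distrib_right by (intro sum.cong) (simp_all add: mult_ac)
    also have "\<dots> \<le> (\<rho> ^ M / (1 - \<rho>)) * (C * Lp_norm p f * B)"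
    proof (rule mult_right_mono)
      have "(1 - \<rho>) * (\<Sum>n=M..<N. \<rho> ^ n) = \<rho> ^ M - \<rho> ^ N"
        using MN
      proof (induction N rule: dec_induct)
        case (step n)
        have "(1 - \<rho>) * (\<Sum>i=M..<Suc n. \<rho> ^ i) = (1 - \<rho>) * (\<Sum>i=M..<n. \<rho> ^ i) + (1 - \<rho>) * \<rho> ^ n"
          using step.hyps by (simp add: distrib_left)
        then show ?case unfolding step.IH by (simp add: left_diff_distrib)
      qed simp
      also have "\<dots> \<le> \<rho> ^ M" using \<rho>_pos by simp
      finally show "(\<Sum>n=M..<N. \<rho> ^ n) \<le> \<rho> ^ M / (1 - \<rho>)" using r1 by (simp add: field_simps)
    qed (use C B in auto)
    finally show ?thesis by (simp add: \<epsilon>_def mult_ac)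
  qed
  interpret series_op "Lp p" "Lp q" "\<lambda>n f. \<rho> ^ n * y n f" h T
  proof (rule series_opI)
    fix f assume f: "in_Lp p f"
    show "\<exists>K. K \<longlonglongrightarrow> 0 \<and> (\<forall>M. \<forall>N\<ge>M. Lp_norm q (\<Sum>n=M..<N. (\<rho> ^ n * y n f) *\<^sub>R h n) \<le> K M)"
      by (intro exI[of _ "\<lambda>M. \<epsilon> M * Lp_norm p f"] conjI allI impI tail[OF f] tendsto_mult_left_zero[OF \<epsilon>])
  qed
  have 1: "nrm (Lp q) (T f - (\<Sum>n<M. (\<rho> ^ n * y n f) *\<^sub>R h n)) \<le> \<epsilon> M * nrm (Lp p) f"
    if "f \<in> carr (Lp p)" for f M
  proof (rule T_tail_le[OF that])
    show "nrm (Lp q) (\<Sum>n=M..<N. (\<rho> ^ n * y n f) *\<^sub>R h n) \<le> \<epsilon> M * nrm (Lp p) f" if "M \<le> N" for N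
      using tail[of f M N] \<open>f \<in> carr (Lp p)\<close> that by simp
  qed
  have 2: "\<bar>\<rho> ^ n * y n f\<bar> \<le> (\<rho> ^ n * C) * nrm (Lp p) f" if "f \<in> carr (Lp p)" for f n
    using y_le[of f n] that \<rho>_pos by (simp add: abs_mult mult_left_mono mult.assoc)
  show "compact_op (Lp p) (Lp q) T" "strictly_singular_op (Lp p) (Lp q) T"
    using T_compact_strictly_singular[OF \<epsilon> 1 2 mcomplete_Lp[OF q]] by blast+
qed

text \<open>Here \<open>\<rho> = 1\<close> and there is no geometric decay. Convergence for each
  single \<open>f\<close> rests on the tails of a convergent \<open>\<ell>\<^sub>v\<close> sum, and
  strict singularity on the gap between the two exponents.\<close>

lemma strictly_singular_on_line:
  assumes line: "d = b / q - a / p" and uv: "seq_exponent a p < seq_exponent b q"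
  shows "strictly_singular_op (Lp p) (Lp q) T"
proof -
  have \<rho>: "\<rho> = 1" by (simp add: \<rho>_def line[symmetric])
  let ?u = "seq_exponent a p" and ?v = "seq_exponent b q"
  obtain C where C: "0 < C" "\<And>N f. in_Lp p f \<Longrightarrow> (\<Sum>n<N. \<bar>y n f\<bar> powr ?u) \<le> (C * Lp_norm p f) powr ?u"
    using y_bound by blast
  obtain D where D: "0 < D" "\<And>I t. finite I \<Longrightarrow>
      Lp_norm q (\<Sum>n\<in>I. t n *\<^sub>R h n) \<le> D * (\<Sum>n\<in>I. \<bar>t n\<bar> powr ?v) powr (1 / ?v)"
    using Lp_norm_Esys_sum_le[OF b q] unfolding h_def by blast
  have v: "(\<Sum>n<N. \<bar>y n f\<bar> powr ?v) \<le> (C * Lp_norm p f) powr ?v" if "in_Lp p f" for N f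
    by (rule sum_powr_le_of_exponent_le[OF _ _ _ C(2)[OF that]]) (use C(1) seq_exponent_gt_1 uv in auto)
  have smb: "summable (\<lambda>n. \<bar>y n f\<bar> powr ?v)" if "in_Lp p f" for f
    using v[OF that] by (intro summableI_nonneg_bounded[where x = "(C * Lp_norm p f) powr ?v"]) auto
  define K where "K f = (\<lambda>M. D * (\<Sum>n. \<bar>y (n + M) f\<bar> powr ?v) powr (1 / ?v))" for f
  have tail: "Lp_norm q (\<Sum>n=M..<N. y n f *\<^sub>R h n) \<le> K f M" if f: "in_Lp p f" and MN: "M \<le> N" for f M N
  proof -
    have "(\<Sum>n=M..<N. \<bar>y n f\<bar> powr ?v) = (\<Sum>n<N-M. \<bar>y (n + M) f\<bar> powr ?v)"
      using MN sum.shift_bounds_nat_ivl[of "\<lambda>n. \<bar>y n f\<bar> powr ?v" 0 M "N - M"] by (simp add: lessThan_atLeast0)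
    also have "\<dots> \<le> (\<Sum>n. \<bar>y (n + M) f\<bar> powr ?v)"
      using summable_ignore_initial_segment[OF smb[OF f]] by (intro sum_le_suminf) auto
    finally have "(\<Sum>n=M..<N. \<bar>y n f\<bar> powr ?v) powr (1 / ?v) \<le> (\<Sum>n. \<bar>y (n + M) f\<bar> powr ?v) powr (1 / ?v)"
      using seq_exponent_gt_1 by (intro powr_mono2 sum_nonneg) auto
    then have "D * (\<Sum>n=M..<N. \<bar>y n f\<bar> powr ?v) powr (1 / ?v) \<le> K f M"
      unfolding K_def using D(1) by (intro mult_left_mono) auto
    then show ?thesis using D(2)[of "{M..<N}" "\<lambda>n. y n f"] by simp
  qed
  have K: "K f \<longlonglongrightarrow> 0" if f: "in_Lp p f" for f
  proof -
    have "(\<lambda>M. (\<Sum>n. \<bar>y (n + M) f\<bar> powr ?v) powr (1 / ?v)) \<longlonglongrightarrow> 0 powr (1 / ?v)"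
      using suminf_exist_split2[OF smb[OF f]] seq_exponent_gt_1
        summable_ignore_initial_segment[OF smb[OF f]]
      by (intro tendsto_powr' tendsto_const) (auto intro!: always_eventually suminf_nonneg)
    then have "(\<lambda>M. (\<Sum>n. \<bar>y (n + M) f\<bar> powr ?v) powr (1 / ?v)) \<longlonglongrightarrow> 0" by simp
    then show ?thesis unfolding K_def by (rule tendsto_mult_right_zero)
  qed
  have "series_op (Lp p) (Lp q) (\<lambda>n f. \<rho> ^ n * y n f) h T"
  proof (rule series_opI)
    fix f assume f: "in_Lp p f"
    show "\<exists>K. K \<longlonglongrightarrow> 0 \<and> (\<forall>M. \<forall>N\<ge>M. Lp_norm q (\<Sum>n=M..<N. (\<rho> ^ n * y n f) *\<^sub>R h n) \<le> K M)"
      by (intro exI[of _ "K f"] conjI allI impI K[OF f]) (simp add: \<rho> tail[OF f])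
  qed
  then interpret series_op "Lp p" "Lp q" y h T by (simp add: \<rho>)
  have low: "nrm (Lp q) (T f) \<le> D * (\<Sum>n. \<bar>y n f\<bar> powr ?v) powr (1 / ?v)" if "f \<in> carr (Lp p)" for f
  proof -
    have "nrm (Lp q) (T f - (\<Sum>n<0. y n f *\<^sub>R h n)) \<le> K f 0"
    proof (rule T_tail_le[OF that])
      show "nrm (Lp q) (\<Sum>n=0..<N. y n f *\<^sub>R h n) \<le> K f 0" for N
        using tail[of f 0 N] that by simp
    qed
    then show ?thesis by (simp add: K_def)
  qed
  have bdd: "bounded_op (Lp p) (Lp q) T"
  proof (rule T_bounded_op)
    fix f assume f: "f \<in> carr (Lp p)"
    have "(\<Sum>n. \<bar>y n f\<bar> powr ?v) \<le> (C * Lp_norm p f) powr ?v"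
      using f by (intro suminf_le_const smb v) auto
    then have "(\<Sum>n. \<bar>y n f\<bar> powr ?v) powr (1 / ?v) \<le> ((C * Lp_norm p f) powr ?v) powr (1 / ?v)"
      using f seq_exponent_gt_1 by (intro powr_mono2) (auto intro!: suminf_nonneg smb)
    also have "\<dots> = C * Lp_norm p f" using C seq_exponent_gt_1 by (simp add: powr_powr)
    finally have "D * (\<Sum>n. \<bar>y n f\<bar> powr ?v) powr (1 / ?v) \<le> D * (C * Lp_norm p f)"
      using D(1) by (intro mult_left_mono) auto
    then show "nrm (Lp q) (T f) \<le> (D * C) * nrm (Lp p) f" using low[OF f] by (simp add: mult.assoc)
  qed
  show ?thesis
  proof (rule T_strictly_singular_lp[of ?u ?v "max C D"])
    fix f assume f: "f \<in> carr (Lp p)"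
    show "(\<Sum>n<N. \<bar>y n f\<bar> powr ?u) \<le> (max C D * nrm (Lp p) f) powr ?u" for N
    proof (rule order_trans)
      show "(\<Sum>n<N. \<bar>y n f\<bar> powr ?u) \<le> (C * Lp_norm p f) powr ?u" using C(2) f by simp
      show "(C * Lp_norm p f) powr ?u \<le> (max C D * nrm (Lp p) f) powr ?u"
        using C(1) seq_exponent_gt_1 by (intro powr_mono2) (auto intro!: mult_right_mono)
    qed
    show "nrm (Lp q) (T f) \<le> max C D * (\<Sum>n. \<bar>y n f\<bar> powr ?v) powr (1 / ?v)"
      by (rule order_trans[OF low[OF f]]) (auto intro!: mult_right_mono)
  qed (use seq_exponent_gt_1 uv C bdd in auto)
qed

text \<open>\<open>g n\<close> is a multiple of a bounded function, so agreement with
  \<open>T\<close> on \<open>L\<^sub>\<infinity>\<close> and homogeneity force the value of every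
  bounded extension.\<close>

lemma extension_g:
  assumes "extends_Linf T T'" "bounded_op (Lp p) (Lp q) T'"
  shows "T' (g n) = (mass a * \<rho> ^ n) *\<^sub>R h n"
proof -
  have "T' (g n) = (2 powr (a * real n / p)) *\<^sub>R T' (Esys a n)"
    using assms(2) p unfolding g_def bounded_op_def by (simp add: in_Lp_Esys)
  also have "T' (Esys a n) = (mass a * 2 powr (d * real n)) *\<^sub>R Esys b n"
    using assms(1) Esys_Linf T_Esys unfolding extends_Linf_def by simp
  also have "(2 powr (a * real n / p)) *\<^sub>R \<dots> = (mass a * \<rho> ^ n) *\<^sub>R h n"
  proof -
    have "2 powr ((d - (b / q - a / p)) * real n) * 2 powr (b * real n / q)
        = (2::real) powr (a * real n / p) * 2 powr (d * real n)"
      by (simp add: powr_add[symmetric] algebra_simps)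
    then show ?thesis by (simp add: h_def \<rho>_power mult_ac)
  qed
  finally show ?thesis .
qed

text \<open>The functions \<open>g n\<close> all have the same norm, while their images have norm
  proportional to \<open>\<rho> ^ n\<close> with \<open>\<rho> > 1\<close>.\<close>

lemma unbounded_below_line:
  assumes "b / q - a / p < d" "extends_Linf T T'"
  shows "\<not> bounded_op (Lp p) (Lp q) T'"
proof
  assume bdd: "bounded_op (Lp p) (Lp q) T'"
  then obtain C where C: "\<And>f. in_Lp p f \<Longrightarrow> Lp_norm q (T' f) \<le> C * Lp_norm p f"
    unfolding bounded_op_def by auto
  have r: "1 < \<rho>" unfolding \<rho>_def using assms(1) powr_less_mono[of 0 "d - (b / q - a / p)" 2] by simp
  define c where "c = mass a * mass b powr (1 / q)"
  have c: "0 < c" using mass_pos[OF a] mass_pos[OF b] by (simp add: c_def)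
  obtain n where n: "C * mass a powr (1 / p) / c < \<rho> ^ n" using real_arch_pow[OF r] by blast
  have "Lp_norm q (T' (g n)) = c * \<rho> ^ n"
    unfolding extension_g[OF assms(2) bdd] using q mass_pos[OF a] \<rho>_pos
    by (simp add: Lp_norm_scaleR norm_h c_def abs_mult)
  moreover have "Lp_norm q (T' (g n)) \<le> C * mass a powr (1 / p)"
    using C[OF g_in_Lp] by (simp add: norm_g)
  ultimately show False using n c by (simp add: divide_less_eq mult.commute)
qed

text \<open>The normalised \<open>g n\<close> lie in the unit ball and go to a fixed multiple of the
  \<open>h n\<close>, which keep a fixed distance from each other; a totally bounded image would
  yield a Cauchy subsequence.\<close>

lemma not_compact_on_line:
  assumes line: "d = b / q - a / p" and ext: "extends_Linf T T'"
  shows "\<not> compact_op (Lp p) (Lp q) T'"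
proof
  assume "compact_op (Lp p) (Lp q) T'"
  then have bdd: "bounded_op (Lp p) (Lp q) T'"
    and cpt: "compactin Y.metric.mtopology (Y.metric.mtopology closure_of (T' ` {f \<in> carr (Lp p). nrm (Lp p) f \<le> 1}))"
    by (auto simp: compact_op_def Y.norm_topology_eq)
  have tb: "Y.metric.mtotally_bounded (T' ` {f \<in> carr (Lp p). nrm (Lp p) f \<le> 1})"
    using bdd by (intro Y.metric.compact_closure_of_imp_mtotally_bounded cpt) (auto simp: bounded_op_def)
  have \<rho>: "\<rho> = 1" by (simp add: \<rho>_def line[symmetric])
  define m where "m = mass a powr (1 / p)"
  have m: "0 < m" using mass_pos[OF a] by (simp add: m_def)
  define s where "s = mass a / m"
  have s: "0 < s" using mass_pos[OF a] m by (simp add: s_def)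
  define \<sigma> where "\<sigma> n = T' ((1 / m) *\<^sub>R g n)" for n
  have \<sigma>: "\<sigma> n = s *\<^sub>R h n" for n
  proof -
    have "\<sigma> n = (1 / m) *\<^sub>R T' (g n)"
      using bdd g_in_Lp[of n] unfolding \<sigma>_def bounded_op_def by simp
    then show ?thesis by (simp add: extension_g[OF ext bdd] \<rho> s_def)
  qed
  have "range \<sigma> \<subseteq> T' ` {f \<in> carr (Lp p). nrm (Lp p) f \<le> 1}"
    using p m by (auto simp: \<sigma>_def m_def in_Lp_scaleR g_in_Lp Lp_norm_scaleR norm_g intro!: imageI)
  then obtain r where r: "strict_mono r" "Y.metric.MCauchy (\<sigma> \<circ> r)"
    using tb unfolding Y.metric.mtotally_bounded_sequentially by blast
  obtain \<delta> where \<delta>: "0 < \<delta>" "\<And>m n. m \<noteq> n \<Longrightarrow> \<delta> \<le> Lp_norm q (h m - h n)"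
    using Esys_separated[OF b q] unfolding h_def by blast
  have "0 < s * \<delta>" using s \<delta>(1) by simp
  then obtain N where N: "\<And>n n'. N \<le> n \<Longrightarrow> N \<le> n' \<Longrightarrow> Lp_norm q (\<sigma> (r n) - \<sigma> (r n')) < s * \<delta>"
    using r(2) unfolding Y.metric.MCauchy_def by (metis comp_apply nrm_Lp)
  have "\<sigma> (r N) - \<sigma> (r (Suc N)) = s *\<^sub>R (h (r N) - h (r (Suc N)))"
    by (simp add: \<sigma> scaleR_diff_right)
  then have "Lp_norm q (\<sigma> (r N) - \<sigma> (r (Suc N))) = s * Lp_norm q (h (r N) - h (r (Suc N)))"
    using s q by (simp add: Lp_norm_scaleR)
  moreover have "r N \<noteq> r (Suc N)" using r(1) by (metis lessI less_irrefl strict_monoD)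
  then have "s * \<delta> \<le> s * Lp_norm q (h (r N) - h (r (Suc N)))" using s \<delta>(2) by (intro mult_left_mono) auto
  ultimately show False using N[of N "Suc N"] by simp
qed

end

section \<open>The regions of the square\<close>

text \<open>\<open>line\<close> is the inequality that gives strict singularity on the line. The
  point in \<open>ex\<close>, on the line or to its left, provides a pair of spaces through which
  \<open>T\<close> is bounded from \<open>L\<^sub>\<infinity>\<close> to
  \<open>L\<^sub>1\<close>.\<close>

lemma (in diagonal_operator) operator_of_line:
  assumes line: "\<And>\<alpha> \<beta>. (\<alpha>, \<beta>) \<in> unit_square \<Longrightarrow> b * \<beta> - a * \<alpha> = d \<Longrightarrow>
      seq_exponent a (1 / \<alpha>) < seq_exponent b (1 / \<beta>)"
    and ex: "(\<alpha>\<^sub>0, \<beta>\<^sub>0) \<in> unit_square" "d \<le> b * \<beta>\<^sub>0 - a * \<alpha>\<^sub>0"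
    and l: "\<And>\<alpha> \<beta>. (\<alpha>, \<beta>) \<in> l \<longleftrightarrow> (\<alpha>, \<beta>) \<in> unit_square \<and> b * \<beta> - a * \<alpha> = d"
    and left: "\<And>\<alpha> \<beta>. (\<alpha>, \<beta>) \<in> left_region l \<longleftrightarrow> (\<alpha>, \<beta>) \<in> unit_square \<and> d < b * \<beta> - a * \<alpha>"
  shows "\<exists>T :: L0 \<Rightarrow> L0. bounded_op Linf (Lp 1) T \<and>
    (L_set T = S_set T \<and> S_set T = left_region l \<union> l) \<and>
    K_set T = left_region l \<and>
    V_set T = l"
proof -
  have at: "diagonal_operator_at a b (1 / \<alpha>) (1 / \<beta>)" if "(\<alpha>, \<beta>) \<in> unit_square" for \<alpha> \<beta>
    using that a b by unfold_locales auto
  have ext: "extends_Linf T T" by (simp add: extends_Linf_def)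
  have S: "strictly_singular_op (Lp (1 / \<alpha>)) (Lp (1 / \<beta>)) T"
    if "(\<alpha>, \<beta>) \<in> unit_square" "d \<le> b * \<beta> - a * \<alpha>" for \<alpha> \<beta>
  proof -
    interpret diagonal_operator_at a b d "1 / \<alpha>" "1 / \<beta>" by (rule at[OF that(1)])
    show ?thesis
      using compact_above_line(2) strictly_singular_on_line line[OF that(1)] that(2)
      by (cases "d < b * \<beta> - a * \<alpha>") auto
  qed
  have K: "compact_op (Lp (1 / \<alpha>)) (Lp (1 / \<beta>)) T"
    if "(\<alpha>, \<beta>) \<in> unit_square" "d < b * \<beta> - a * \<alpha>" for \<alpha> \<beta>
  proof -
    interpret diagonal_operator_at a b d "1 / \<alpha>" "1 / \<beta>" by (rule at[OF that(1)])
    show ?thesis using compact_above_line(1) that(2) by simp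
  qed
  \<comment> \<open>The negative statements are proved for an arbitrary \<open>T'\<close>, since
    membership in the sets only asks that some extension exist.\<close>
  have nL: "d \<le> b * \<beta> - a * \<alpha>"
    if "(\<alpha>, \<beta>) \<in> unit_square" "extends_Linf T T'" "bounded_op (Lp (1 / \<alpha>)) (Lp (1 / \<beta>)) T'" for \<alpha> \<beta> T'
  proof -
    interpret diagonal_operator_at a b d "1 / \<alpha>" "1 / \<beta>" by (rule at[OF that(1)])
    show ?thesis using unbounded_below_line[of T'] that by force
  qed
  have nK: "d < b * \<beta> - a * \<alpha>"
    if "(\<alpha>, \<beta>) \<in> unit_square" "extends_Linf T T'" "compact_op (Lp (1 / \<alpha>)) (Lp (1 / \<beta>)) T'" for \<alpha> \<beta> T'
  proof -
    interpret diagonal_operator_at a b d "1 / \<alpha>" "1 / \<beta>" by (rule at[OF that(1)])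
    have "d \<le> b * \<beta> - a * \<alpha>" using nL that by (auto simp: compact_op_def)
    moreover have "d \<noteq> b * \<beta> - a * \<alpha>" using not_compact_on_line[of T'] that by auto
    ultimately show ?thesis by simp
  qed
  note strict = S
  have bddS: "bounded_op X Y T'" if "strictly_singular_op X Y T'" for X Y :: "L0 nspace" and T'
    using that by (simp add: strictly_singular_op_def)
  have L_iff: "(\<exists>T'. extends_Linf T T' \<and> bounded_op (Lp (1 / \<alpha>)) (Lp (1 / \<beta>)) T') \<longleftrightarrow> d \<le> b * \<beta> - a * \<alpha>"
    and S_iff: "(\<exists>T'. extends_Linf T T' \<and> strictly_singular_op (Lp (1 / \<alpha>)) (Lp (1 / \<beta>)) T') \<longleftrightarrow> d \<le> b * \<beta> - a * \<alpha>"
    and K_iff: "(\<exists>T'. extends_Linf T T' \<and> compact_op (Lp (1 / \<alpha>)) (Lp (1 / \<beta>)) T') \<longleftrightarrow> d < b * \<beta> - a * \<alpha>"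
    if sq: "(\<alpha>, \<beta>) \<in> unit_square" for \<alpha> \<beta>
    using S[OF sq] K[OF sq] nL[OF sq] nK[OF sq] ext bddS by blast+
  have L: "z \<in> L_set T \<longleftrightarrow> z \<in> left_region l \<union> l" for z
  proof (cases z)
    case (Pair \<alpha> \<beta>)
    have "z \<in> L_set T \<longleftrightarrow> (\<alpha>, \<beta>) \<in> unit_square \<and> d \<le> b * \<beta> - a * \<alpha>"
      unfolding Pair L_set_def mem_Collect_eq case_prod_conv using L_iff[of \<alpha> \<beta>] by blast
    then show ?thesis unfolding Pair Un_iff l left by argo
  qed
  have S: "z \<in> S_set T \<longleftrightarrow> z \<in> left_region l \<union> l" for z
  proof (cases z)
    case (Pair \<alpha> \<beta>)
    have "z \<in> S_set T \<longleftrightarrow> (\<alpha>, \<beta>) \<in> unit_square \<and> d \<le> b * \<beta> - a * \<alpha>"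
      unfolding Pair S_set_def mem_Collect_eq case_prod_conv using S_iff[of \<alpha> \<beta>] by blast
    then show ?thesis unfolding Pair Un_iff l left by argo
  qed
  have K: "z \<in> K_set T \<longleftrightarrow> z \<in> left_region l" for z
  proof (cases z)
    case (Pair \<alpha> \<beta>)
    show ?thesis
      unfolding Pair left K_set_def mem_Collect_eq case_prod_conv using K_iff[of \<alpha> \<beta>] by blast
  qed
  have disj: "z \<notin> left_region l" if "z \<in> l" for z
    using that l[of "fst z" "snd z"] left[of "fst z" "snd z"] by (simp only: prod.collapse) argo
  have V: "z \<in> V_set T \<longleftrightarrow> z \<in> l" for z
    unfolding V_set_def Diff_iff S K using disj[of z] by blast
  \<comment> \<open>Boundedness of \<open>T\<close> comes from the chain \<open>L\<^sub>\<infinity>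
    \<rightarrow> L\<^sub>p \<rightarrow> L\<^sub>q \<rightarrow> L\<^sub>1\<close> at the given
    point.\<close>
  define p where "p = 1 / \<alpha>\<^sub>0"
  define q where "q = 1 / \<beta>\<^sub>0"
  have pq: "1 < p" "1 < q" using ex(1) by (auto simp: p_def q_def)
  have bdd: "bounded_op (Lp p) (Lp q) T"
    using bddS[OF strict[OF ex]] by (simp add: strictly_singular_op_def p_def q_def)
  then obtain C where C: "\<And>f. in_Lp p f \<Longrightarrow> Lp_norm q (T f) \<le> C * Lp_norm p f"
    unfolding bounded_op_def by auto
  have Linf: "in_Lp p f" "Lp_norm p f \<le> nrm Linf f" if "f \<in> carr Linf" for f
    using in_LinfD[of p f] pq that by auto
  have Tq: "in_Lp q (T f)" if "f \<in> carr Linf" for f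
    using bdd Linf(1)[OF that] unfolding bounded_op_def by auto
  have "bounded_op Linf (Lp 1) T"
    unfolding bounded_op_def
  proof (intro conjI exI[of _ "\<bar>C\<bar>"])
    show "T ` carr Linf \<subseteq> carr (Lp 1)" using Lp_subset(1)[OF pq(2)] Tq by auto
    show "\<forall>f\<in>carr Linf. nrm (Lp 1) (T f) \<le> \<bar>C\<bar> * nrm Linf f"
    proof
      fix f assume f: "f \<in> carr Linf"
      have "Lp_norm 1 (T f) \<le> Lp_norm q (T f)" by (rule Lp_subset(2)[OF pq(2) Tq[OF f]])
      also have "\<dots> \<le> C * Lp_norm p f" by (rule C[OF Linf(1)[OF f]])
      also have "\<dots> \<le> \<bar>C\<bar> * nrm Linf f" using Linf(2)[OF f] by (intro mult_mono) auto
      finally show "nrm (Lp 1) (T f) \<le> \<bar>C\<bar> * nrm Linf f" by simp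
    qed
  qed (use bdd Linf(1) in \<open>auto simp: bounded_op_def\<close>)
  moreover have "L_set T = left_region l \<union> l" "S_set T = left_region l \<union> l"
    "K_set T = left_region l" "V_set T = l"
    by (rule set_eqI, rule L S K V)+
  ultimately show ?thesis by metis
qed

theorem theorem9:
  fixes l :: "(real \<times> real) set"
  assumes "l \<in> admissible_lines"
  shows "\<exists>T :: L0 \<Rightarrow> L0. bounded_op Linf (Lp 1) T \<and>
    (L_set T = S_set T \<and> S_set T = left_region l \<union> l) \<and>
    K_set T = left_region l \<and>
    V_set T = l"
proof -
  obtain k c where k: "0 \<le> k" and l: "l = affine_line k c \<inter> unit_square"
    and adm: "k \<in> {0, \<infinity>} \<and> l \<inter> corner = {} \<or> 0 < k \<and> (\<forall>(\<alpha>, \<beta>) \<in> l. \<beta> < \<alpha>)"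
    using assms unfolding admissible_lines_def by blast
  show ?thesis
  proof (cases "l = {}")
    case True
    \<comment> \<open>For \<open>a = b = 0\<close> and \<open>d = -1\<close> the equation of the
      line has no solution and every point of the square counts as left of it. The operator is
      compact throughout, in accordance with \<open>left_region_empty\<close>.\<close>
    show ?thesis
      by (rule diagonal_operator.operator_of_line[of 0 0 "-1" "1/2" "1/2"])
        (auto simp: True left_region_empty diagonal_operator_def)
  next
    case False
    then obtain \<alpha>\<^sub>0 \<beta>\<^sub>0 where pt: "(\<alpha>\<^sub>0, \<beta>\<^sub>0) \<in> l" by auto
    note left = left_region_affine_line[OF k l False adm]
    show ?thesis
    proof (cases "k = \<infinity>")
      case True
      have mem: "(\<alpha>, \<beta>) \<in> l \<longleftrightarrow> (\<alpha>, \<beta>) \<in> unit_square \<and> \<alpha> = c" for \<alpha> \<beta>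
        using True by (auto simp: l affine_line_def)
      have c: "0 < c" "c < 1" using pt mem by auto
      \<comment> \<open>A point of the diagonal, so the line must be admissible through the
        condition on \<open>corner\<close>.\<close>
      have "(c, c) \<in> l" using c by (simp add: mem)
      then have disj: "l \<inter> corner = {}" using adm by auto
      \<comment> \<open>Otherwise the vertical line would pass through the boundary point
        \<open>(c, 1/2)\<close> of \<open>corner\<close>.\<close>
      have "1/2 < c"
      proof (rule ccontr)
        assume "\<not> 1/2 < c"
        then have "(c, 1/2) \<in> l \<inter> corner" using c by (simp add: mem corner_def)
        then show False using disj by blast
      qed
      \<comment> \<open>The vertical line has the equation
        \<open>0 * \<beta> - 1 * \<alpha> = - c\<close>: intervals on the domain side, Rademacher
        functions on the range side, and \<open>1 / c < 2\<close> is the required inequality of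
        exponents.\<close>
      show ?thesis
      proof (rule diagonal_operator.operator_of_line[of 1 0 "- c" \<alpha>\<^sub>0 \<beta>\<^sub>0])
        show "seq_exponent 1 (1 / \<alpha>) < seq_exponent 0 (1 / \<beta>)"
          if "(\<alpha>, \<beta>) \<in> unit_square" "0 * \<beta> - 1 * \<alpha> = - c" for \<alpha> \<beta>
          using \<open>1/2 < c\<close> that by (simp add: seq_exponent_def field_simps)
        show "(\<alpha>, \<beta>) \<in> left_region l \<longleftrightarrow> (\<alpha>, \<beta>) \<in> unit_square \<and> - c < 0 * \<beta> - 1 * \<alpha>" for \<alpha> \<beta>
          using True by (simp add: left)
      qed (use pt mem in \<open>auto simp: diagonal_operator_def\<close>)
    next
      case False
      define m where "m = real_of_ereal k"
      have m0: "0 \<le> m" using k by (simp add: m_def real_of_ereal_pos)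
      have mem: "(\<alpha>, \<beta>) \<in> l \<longleftrightarrow> (\<alpha>, \<beta>) \<in> unit_square \<and> \<beta> = m * \<alpha> + c" for \<alpha> \<beta>
        using False by (auto simp: l affine_line_def m_def)
      \<comment> \<open>For slope 0 the exponents are 2 and \<open>1 / \<beta>\<close>, and avoiding
        \<open>corner\<close> forces \<open>\<beta> < 1/2\<close>; for positive slope they are
        \<open>1 / \<alpha>\<close> and \<open>1 / \<beta>\<close>, and the line lies below the
        diagonal.\<close>
      have line: "seq_exponent m (1 / \<alpha>) < seq_exponent 1 (1 / \<beta>)"
        if "(\<alpha>, \<beta>) \<in> unit_square" "\<beta> = m * \<alpha> + c" for \<alpha> \<beta>
      proof (cases "m = 0")
        case True
        then have "k = 0" using False k by (cases k) (auto simp: m_def)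
        then have disj: "l \<inter> corner = {}" using adm by auto
        have "\<beta> < 1/2"
        proof (rule ccontr)
          assume "\<not> \<beta> < 1/2"
          then have "(1/2, \<beta>) \<in> l \<inter> corner" using that True by (simp add: mem corner_def)
          then show False using disj by blast
        qed
        then show ?thesis using that True by (simp add: seq_exponent_def field_simps)
      next
        case m: False
        then have "k \<noteq> 0" by (auto simp: m_def)
        then have "\<forall>(\<alpha>, \<beta>) \<in> l. \<beta> < \<alpha>" using adm False by auto
        then have "\<beta> < \<alpha>" using that mem[of \<alpha> \<beta>] by blast
        then show ?thesis using that(1) m by (simp add: seq_exponent_def field_simps)
      qed
      show ?thesis
      proof (rule diagonal_operator.operator_of_line[of m 1 c \<alpha>\<^sub>0 \<beta>\<^sub>0])
        show "seq_exponent m (1 / \<alpha>) < seq_exponent 1 (1 / \<beta>)"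
          if "(\<alpha>, \<beta>) \<in> unit_square" "1 * \<beta> - m * \<alpha> = c" for \<alpha> \<beta>
          using line[OF that(1)] that(2) by simp
        show "(\<alpha>, \<beta>) \<in> l \<longleftrightarrow> (\<alpha>, \<beta>) \<in> unit_square \<and> 1 * \<beta> - m * \<alpha> = c" for \<alpha> \<beta>
          unfolding mem by auto
        show "(\<alpha>, \<beta>) \<in> left_region l \<longleftrightarrow> (\<alpha>, \<beta>) \<in> unit_square \<and> c < 1 * \<beta> - m * \<alpha>" for \<alpha> \<beta>
          using False by (simp add: left m_def less_diff_eq add.commute)
      qed (use pt mem m0 in \<open>auto simp: diagonal_operator_def\<close>)
    qed
  qed
qed

end
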